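(* (Caccioppoli's inequality) Let $T>0$, $Q_T=(0,T)\times(0,1)$, and let $a,b,\lambda$ satisfy hypothesis (B) of the context. Let $\omega'$ and $\omega$ be two open subintervals of $(0,1)$ such that $\omega'\subset\subset\omega\subset(0,1)$ and $x_0\notin\bar\omega'$. Let $\varphi(t,x)=\Theta(t)\Upsilon(x)$, where $\Theta(t)=\frac1{[t(T-t)]^4}$ and $$\Upsilon\in C([0,1],(-\infty,0))\cap C^1([0,1]\setminus\{x_0\},(-\infty,0))$$ is such that $$|\Upsilon_x|\le\frac{c}{\sqrt a}\quad\text{in }[0,1]\setminus\{x_0\}$$ for some $c>0$. Then there exist two positive constants $C$ and $s_0$ such that every solution $v$ of $$\begin{cases} v_t+Av=0, & (t,x)\in Q_T,\\ v(t,0)=v(t,1)=0, & t\in(0,T),\\ v(T,x)=v_T(x)\in D(A^2),\end{cases}$$ satisfies $$\int_0^T\int_{\omega'}(v_x)^2e^{2s\varphi}\,dx\,dt\le C\int_0^T\int_\omega v^2\,dx\,dt$$ for all $s\ge s_0$.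
   Context: Degeneracy hypotheses. Each of the following assumes that there is $x_0\in(0,1)$ with $a(x_0)=b(x_0)=0$, $a,b>0$ on $[0,1]\setminus\{x_0\}$, and constants $K_1,K_2$ with $(x-x_0)a'\le K_1a$ and $(x-x_0)b'\le K_2b$ a.e. in $[0,1]$. In addition: (WWD) $a,b\in W^{1,1}(0,1)$, $K_1,K_2\in(0,1)$; (WSD) $a\in W^{1,1}(0,1)$, $b\in W^{1,\infty}(0,1)$, $K_1\in(0,1)$, $K_2\ge1$; (SWD) $a\in W^{1,\infty}(0,1)$, $b\in W^{1,1}(0,1)$, $K_1\ge1$, $K_2\in(0,1)$; (SSD) $a,b\in W^{1,\infty}(0,1)$, $K_1,K_2\ge1$. Spaces. $H^1_a(0,1)=\{u\in W^{1,1}_0(0,1):\sqrt a\,u'\in L^2(0,1)\}$; $\mathcal H=H^1_{a,b}(0,1)=\{u\in H^1_a(0,1): u/\sqrt b\in L^2(0,1)\}$; $H^2_{a,b}(0,1)=\{u\in H^1_a(0,1): au'\in H^1(0,1),\ (au')'+\frac{\lambda}{b}u\in L^2(0,1)\}$. Operator. $Au=(au')'+\frac{\lambda}{b}u$ with $D(A)=H^2_{a,b}(0,1)$, and $D(A^2)=\{u\in D(A): Au\in D(A)\}$. Solutions with final datum in $D(A^2)$ belong to $C^1([0,T];H^2_{a,b}(0,1))$. Constant $C^*$: the best (smallest) constant $C$ such that $\int_0^1\frac{u^2}{b}dx\le C\int_0^1a(u')^2dx$ for all $u\in\mathcal H$ (such a $C$ exists under (WWD), (WSD) or (SWD) with $K_1+K_2\le2$).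 Hypothesis (B): either (1) one of (WWD), (WSD), (SWD) holds with $K_1+K_2\le2$ and $\lambda\in(0,1/C^* )$; or (2) one of (WWD), (WSD), (SWD), (SSD) holds and $\lambda<0$. *)

theory Defs
  imports "HOL-Analysis.Analysis"
begin

text \<open>
  Elements of the function spaces below are functions \<open>real \<Rightarrow> real\<close>, of which only the values
  on \<open>(0,1)\<close> matter; equality of classes is equality almost everywhere on \<open>(0,1)\<close>.
\<close>

abbreviation I01 :: "real measure" where
  "I01 \<equiv> lebesgue_on {0<..<1}"

definition L1 :: "(real \<Rightarrow> real) set" where
  "L1 = {u. integrable I01 u}"

definition L2 :: "(real \<Rightarrow> real) set" where
  "L2 = {u. u \<in> borel_measurable I01 \<and> integrable I01 (\<lambda>x. (u x)\<^sup>2)}"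

definition Linf :: "(real \<Rightarrow> real) set" where
  "Linf = {u. u \<in> borel_measurable I01 \<and> (\<exists>M. AE x in I01. \<bar>u x\<bar> \<le> M)}"

definition L2norm :: "(real \<Rightarrow> real) \<Rightarrow> real" where
  "L2norm u = sqrt (\<integral>x. (u x)\<^sup>2 \<partial>I01)"

definition L1loc :: "(real \<Rightarrow> real) set" where
  "L1loc = {u. \<forall>K. compact K \<and> K \<subseteq> {0<..<1} \<longrightarrow> set_integrable lebesgue K u}"

definition test_fun :: "(real \<Rightarrow> real) \<Rightarrow> bool" where
  "test_fun \<psi> \<longleftrightarrow>
     (\<forall>k x. ((deriv ^^ k) \<psi>) differentiable (at x)) \<and> closure {x. \<psi> x \<noteq> 0} \<subseteq> {0<..<1}"

definition has_weak_deriv :: "(real \<Rightarrow> real) \<Rightarrow> (real \<Rightarrow> real) \<Rightarrow> bool" where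
  "has_weak_deriv u g \<longleftrightarrow> u \<in> L1loc \<and> g \<in> L1loc \<and>
     (\<forall>\<psi>. test_fun \<psi> \<longrightarrow> (\<integral>x. u x * deriv \<psi> x \<partial>I01) = - (\<integral>x. g x * \<psi> x \<partial>I01))"

text \<open>The weak derivative is unique up to null sets; \<open>wderiv u\<close> is some representative of it.\<close>

definition wderiv :: "(real \<Rightarrow> real) \<Rightarrow> real \<Rightarrow> real" where
  "wderiv u = (SOME g. has_weak_deriv u g)"

definition Sobolev1 :: "(real \<Rightarrow> real) set \<Rightarrow> (real \<Rightarrow> real) set" where
  "Sobolev1 X = {u \<in> X. (\<exists>g. has_weak_deriv u g) \<and> wderiv u \<in> X}"

abbreviation W11 :: "(real \<Rightarrow> real) set" where "W11 \<equiv> Sobolev1 L1"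
abbreviation W1inf :: "(real \<Rightarrow> real) set" where "W1inf \<equiv> Sobolev1 Linf"
abbreviation H1 :: "(real \<Rightarrow> real) set" where "H1 \<equiv> Sobolev1 L2"

text \<open>\<open>W110\<close> is the closure of the test functions in the \<open>W\<^sup>1\<^sup>,\<^sup>1\<close> norm.\<close>

definition W110 :: "(real \<Rightarrow> real) set" where
  "W110 = {u \<in> W11. \<exists>\<psi> :: nat \<Rightarrow> real \<Rightarrow> real. (\<forall>n. test_fun (\<psi> n)) \<and>
     (\<lambda>n. (\<integral>x. \<bar>u x - \<psi> n x\<bar> \<partial>I01) + (\<integral>x. \<bar>wderiv u x - deriv (\<psi> n) x\<bar> \<partial>I01))
       \<longlonglongrightarrow> 0}"


definition H1a :: "(real \<Rightarrow> real) \<Rightarrow> (real \<Rightarrow> real) set" where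
  "H1a a = {u \<in> W110. (\<lambda>x. sqrt (a x) * wderiv u x) \<in> L2}"

definition H1ab :: "(real \<Rightarrow> real) \<Rightarrow> (real \<Rightarrow> real) \<Rightarrow> (real \<Rightarrow> real) set" where
  "H1ab a b = {u \<in> H1a a. (\<lambda>x. u x / sqrt (b x)) \<in> L2}"

definition opA :: "(real \<Rightarrow> real) \<Rightarrow> (real \<Rightarrow> real) \<Rightarrow> real \<Rightarrow> (real \<Rightarrow> real) \<Rightarrow> real \<Rightarrow> real" where
  "opA a b lam u = (\<lambda>x. wderiv (\<lambda>y. a y * wderiv u y) x + lam / b x * u x)"

definition H2ab :: "(real \<Rightarrow> real) \<Rightarrow> (real \<Rightarrow> real) \<Rightarrow> real \<Rightarrow> (real \<Rightarrow> real) set" where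
  "H2ab a b lam = {u \<in> H1a a. (\<lambda>x. a x * wderiv u x) \<in> H1 \<and> opA a b lam u \<in> L2}"

definition domA2 :: "(real \<Rightarrow> real) \<Rightarrow> (real \<Rightarrow> real) \<Rightarrow> real \<Rightarrow> (real \<Rightarrow> real) set" where
  "domA2 a b lam = {u \<in> H2ab a b lam. opA a b lam u \<in> H2ab a b lam}"

text \<open>
  The set of admissible constants is closed and bounded below, so if it is nonempty then its
  infimum is its smallest element.
\<close>

definition Cstar :: "(real \<Rightarrow> real) \<Rightarrow> (real \<Rightarrow> real) \<Rightarrow> real" where
  "Cstar a b = Inf {C. \<forall>u \<in> H1ab a b.
     (\<integral>x. (u x)\<^sup>2 / b x \<partial>I01) \<le> C * (\<integral>x. a x * (wderiv u x)\<^sup>2 \<partial>I01)}"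


text \<open>
  The pointwise conditions on \<open>a\<close> and \<open>b\<close> refer to their continuous representatives, hence the
  explicit continuity.
\<close>

definition degenerate ::
  "(real \<Rightarrow> real) \<Rightarrow> (real \<Rightarrow> real) \<Rightarrow> real \<Rightarrow> real \<Rightarrow> real \<Rightarrow> bool" where
  "degenerate a b x0 K1 K2 \<longleftrightarrow>
     continuous_on {0..1} a \<and> continuous_on {0..1} b \<and>
     x0 \<in> {0<..<1} \<and> a x0 = 0 \<and> b x0 = 0 \<and>
     (\<forall>x \<in> {0..1} - {x0}. a x > 0 \<and> b x > 0) \<and>
     (AE x in I01. (x - x0) * wderiv a x \<le> K1 * a x) \<and>
     (AE x in I01. (x - x0) * wderiv b x \<le> K2 * b x)"

definition WWD :: "(real \<Rightarrow> real) \<Rightarrow> (real \<Rightarrow> real) \<Rightarrow> real \<Rightarrow> real \<Rightarrow> real \<Rightarrow> bool" where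
  "WWD a b x0 K1 K2 \<longleftrightarrow> degenerate a b x0 K1 K2 \<and>
     a \<in> W11 \<and> b \<in> W11 \<and> K1 \<in> {0<..<1} \<and> K2 \<in> {0<..<1}"

definition WSD :: "(real \<Rightarrow> real) \<Rightarrow> (real \<Rightarrow> real) \<Rightarrow> real \<Rightarrow> real \<Rightarrow> real \<Rightarrow> bool" where
  "WSD a b x0 K1 K2 \<longleftrightarrow> degenerate a b x0 K1 K2 \<and>
     a \<in> W11 \<and> b \<in> W1inf \<and> K1 \<in> {0<..<1} \<and> K2 \<ge> 1"

definition SWD :: "(real \<Rightarrow> real) \<Rightarrow> (real \<Rightarrow> real) \<Rightarrow> real \<Rightarrow> real \<Rightarrow> real \<Rightarrow> bool" where
  "SWD a b x0 K1 K2 \<longleftrightarrow> degenerate a b x0 K1 K2 \<and>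
     a \<in> W1inf \<and> b \<in> W11 \<and> K1 \<ge> 1 \<and> K2 \<in> {0<..<1}"

definition SSD :: "(real \<Rightarrow> real) \<Rightarrow> (real \<Rightarrow> real) \<Rightarrow> real \<Rightarrow> real \<Rightarrow> real \<Rightarrow> bool" where
  "SSD a b x0 K1 K2 \<longleftrightarrow> degenerate a b x0 K1 K2 \<and>
     a \<in> W1inf \<and> b \<in> W1inf \<and> K1 \<ge> 1 \<and> K2 \<ge> 1"

definition hypB ::
  "(real \<Rightarrow> real) \<Rightarrow> (real \<Rightarrow> real) \<Rightarrow> real \<Rightarrow> real \<Rightarrow> real \<Rightarrow> real \<Rightarrow> bool" where
  "hypB a b x0 K1 K2 lam \<longleftrightarrow>
     ((WWD a b x0 K1 K2 \<or> WSD a b x0 K1 K2 \<or> SWD a b x0 K1 K2) \<and>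
       K1 + K2 \<le> 2 \<and> 0 < lam \<and> lam < 1 / Cstar a b) \<or>
     ((WWD a b x0 K1 K2 \<or> WSD a b x0 K1 K2 \<or> SWD a b x0 K1 K2 \<or> SSD a b x0 K1 K2) \<and>
       lam < 0)"


definition L2_continuous_on :: "real set \<Rightarrow> (real \<Rightarrow> real \<Rightarrow> real) \<Rightarrow> bool" where
  "L2_continuous_on S f \<longleftrightarrow> (\<forall>t\<in>S. f t \<in> L2) \<and>
     (\<forall>t\<in>S. ((\<lambda>r. L2norm (\<lambda>x. f r x - f t x)) \<longlongrightarrow> 0) (at t within S))"

definition has_L2_derivative_on ::
  "real set \<Rightarrow> (real \<Rightarrow> real \<Rightarrow> real) \<Rightarrow> (real \<Rightarrow> real \<Rightarrow> real) \<Rightarrow> bool" where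
  "has_L2_derivative_on S f f' \<longleftrightarrow> (\<forall>t\<in>S. f t \<in> L2 \<and> f' t \<in> L2) \<and>
     (\<forall>t\<in>S. ((\<lambda>r. L2norm (\<lambda>x. (f r x - f t x) / (r - t) - f' t x)) \<longlongrightarrow> 0) (at t within S))"

text \<open>
  Classical solutions, in \<open>C([0,T]; D(A)) \<inter> C\<^sup>1([0,T]; L\<^sup>2(0,1))\<close> with the graph norm on \<open>D(A)\<close>,
  of \<open>v\<^sub>t + A v = 0\<close> with final datum \<open>vT\<close>. This contains \<open>C\<^sup>1([0,T]; D(A))\<close>. The boundary
  condition \<open>v(t,0) = v(t,1) = 0\<close> is part of \<open>v t \<in> H2ab a b lam\<close>, which is contained in \<open>W110\<close>.
\<close>

definition is_solution ::
  "(real \<Rightarrow> real) \<Rightarrow> (real \<Rightarrow> real) \<Rightarrow> real \<Rightarrow> real \<Rightarrow> (real \<Rightarrow> real) \<Rightarrow> (real \<Rightarrow> real \<Rightarrow> real) \<Rightarrow> bool"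
where
  "is_solution a b lam T vT v \<longleftrightarrow>
     (\<forall>t\<in>{0..T}. v t \<in> H2ab a b lam) \<and>
     L2_continuous_on {0..T} v \<and>
     L2_continuous_on {0..T} (\<lambda>t. opA a b lam (v t)) \<and>
     (\<exists>vt. has_L2_derivative_on {0..T} v vt \<and> L2_continuous_on {0..T} vt \<and>
        (\<forall>t\<in>{0<..<T}. AE x in I01. vt t x + opA a b lam (v t) x = 0)) \<and>
     (AE x in I01. v T x = vT x)"


definition Theta :: "real \<Rightarrow> real \<Rightarrow> real" where
  "Theta T t = 1 / (t * (T - t)) ^ 4"

definition phi :: "real \<Rightarrow> (real \<Rightarrow> real) \<Rightarrow> real \<Rightarrow> real \<Rightarrow> real" where
  "phi T Y t x = Theta T t * Y x"

end

theory Submission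
  imports Defs
begin

text \<open>
  Let \<open>\<theta>\<close> be a bump supported in a compact interval \<open>[y,z] \<subseteq> \<omega> - {x\<^sub>0}\<close> and positive on the closure of
  \<open>\<omega>'\<close>. Integrating the equation against \<open>\<theta>\<^sup>2 v\<close> and using Young's inequality gives, for every
  \<open>t \<in> (0,T)\<close>, the bound \<open>\<integral> \<theta>\<^sup>2 a v\<^sub>x\<^sup>2 \<le> F'(t) + M \<integral>\<^sub>[\<^sub>y\<^sub>,\<^sub>z\<^sub>] v\<^sup>2\<close> with \<open>F(t) = \<integral> \<theta>\<^sup>2 v\<^sup>2\<close>. On \<open>\<omega>'\<close> one has \<open>\<Upsilon> \<le> -m < 0\<close>,
  so \<open>exp (2 s \<phi>) \<le> \<eta> / (2 m)\<close> for \<open>s \<ge> 1\<close>, where \<open>\<eta>(t) = (t (T - t))\<^sup>4 = 1 / \<Theta>(t)\<close>. Hence it suffices to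
  multiply the bound by \<open>\<eta>\<close> and to integrate in time: \<open>\<eta>\<close> vanishes at \<open>0\<close> and \<open>T\<close>, so \<open>\<integral> \<eta> F' = - \<integral> \<eta>' F\<close>.

  The integration by parts in space uses the approximation of \<open>v\<close> by test functions \<open>\<psi>\<^sub>n\<close> in \<open>W\<^sup>1\<^sup>,\<^sup>1\<close>: the
  weak formulation of \<open>(a v\<^sub>x)\<^sub>x\<close> is applied to \<open>\<theta>\<^sup>2 \<psi>\<^sub>n\<close>, and the limit is justified because \<open>\<theta>\<^sup>2 a v\<^sub>x\<close> is
  bounded almost everywhere.
\<close>

subsection \<open>Smooth functions and bumps\<close>

text \<open>The derivative is an existential witness instead of an iterate of \<open>deriv\<close>,
  so that sums and products are treated by exhibiting a derivative. \<open>smooth_iff\<close>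
  translates back to the iterated \<open>deriv\<close> in \<open>test_fun\<close>.\<close>

primrec differentiable_upto :: "nat \<Rightarrow> (real \<Rightarrow> real) \<Rightarrow> bool" where
  "differentiable_upto 0 f \<longleftrightarrow> True"
| "differentiable_upto (Suc k) f \<longleftrightarrow>
     (\<exists>f'. (\<forall>x. (f has_real_derivative f' x) (at x)) \<and> differentiable_upto k f')"

definition smooth :: "(real \<Rightarrow> real) \<Rightarrow> bool" where
  "smooth f \<longleftrightarrow> (\<forall>k. differentiable_upto k f)"

lemma differentiable_upto_pred: "differentiable_upto (Suc k) f \<Longrightarrow> differentiable_upto k f"
  by (induction k arbitrary: f) (simp, metis differentiable_upto.simps(2))

lemma differentiable_upto_const: "differentiable_upto k (\<lambda>x. c)"
  by (induction k arbitrary: c) (auto intro!: exI[of _ "\<lambda>x. 0"])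

lemma differentiable_upto_add:
  "differentiable_upto k f \<Longrightarrow> differentiable_upto k g \<Longrightarrow> differentiable_upto k (\<lambda>x. f x + g x)"
proof (induction k arbitrary: f g)
  case (Suc k)
  then obtain f' g' where *: "\<forall>x. (f has_real_derivative f' x) (at x)" "differentiable_upto k f'"
    "\<forall>x. (g has_real_derivative g' x) (at x)" "differentiable_upto k g'"
    by auto
  show ?case
    by (simp only: differentiable_upto.simps, rule exI[of _ "\<lambda>x. f' x + g' x"])
       (use * Suc.IH in \<open>auto intro!: derivative_eq_intros\<close>)
qed simp

lemma differentiable_upto_mult:
  "differentiable_upto k f \<Longrightarrow> differentiable_upto k g \<Longrightarrow> differentiable_upto k (\<lambda>x. f x * g x)"
proof (induction k arbitrary: f g)
  case (Suc k)
  then obtain f' g' where *: "\<forall>x. (f has_real_derivative f' x) (at x)" "differentiable_upto k f'"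
    "\<forall>x. (g has_real_derivative g' x) (at x)" "differentiable_upto k g'"
    by auto
  \<comment> \<open>The product rule keeps one factor undifferentiated, so \<open>f\<close> and
    \<open>g\<close> are needed at order \<open>k\<close> as well.\<close>
  have "differentiable_upto k f" "differentiable_upto k g"
    using Suc.prems differentiable_upto_pred by blast+
  then have "differentiable_upto k (\<lambda>x. f' x * g x + g' x * f x)"
    using Suc.IH * by (intro differentiable_upto_add) auto
  moreover have "\<forall>x. ((\<lambda>x. f x * g x) has_real_derivative f' x * g x + g' x * f x) (at x)"
    using * by (auto intro!: derivative_eq_intros)
  ultimately show ?case
    by auto
qed simp

lemma smooth_const: "smooth (\<lambda>x. c)"
  and smooth_add: "smooth f \<Longrightarrow> smooth g \<Longrightarrow> smooth (\<lambda>x. f x + g x)"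
  and smooth_mult: "smooth f \<Longrightarrow> smooth g \<Longrightarrow> smooth (\<lambda>x. f x * g x)"
  by (auto simp: smooth_def differentiable_upto_const intro: differentiable_upto_add differentiable_upto_mult)

lemma smooth_if_has_smooth_derivative:
  assumes "\<And>x. (f has_real_derivative f' x) (at x)" "smooth f'"
  shows "smooth f"
proof -
  have "differentiable_upto k f" for k
    using assms by (cases k) (auto simp: smooth_def)
  then show ?thesis by (simp add: smooth_def)
qed

lemma smooth_ident: "smooth (\<lambda>x. x)"
  by (rule smooth_if_has_smooth_derivative[OF DERIV_ident smooth_const])

lemma smooth_diff: "smooth f \<Longrightarrow> smooth g \<Longrightarrow> smooth (\<lambda>x. f x - g x)"
  using smooth_add[of f "\<lambda>x. (-1) * g x"] smooth_mult[OF smooth_const, of g "-1"] by simp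

lemma smooth_has_deriv: "smooth f \<Longrightarrow> (f has_real_derivative deriv f x) (at x)"
  unfolding smooth_def by (drule spec[of _ "Suc 0"]) (metis DERIV_imp_deriv differentiable_upto.simps(2))

lemma smooth_deriv:
  assumes "smooth f"
  shows "smooth (deriv f)"
  unfolding smooth_def
proof
  fix k
  have "differentiable_upto (Suc k) f"
    using assms by (simp add: smooth_def)
  then obtain f' where f': "\<forall>x. (f has_real_derivative f' x) (at x)" "differentiable_upto k f'"
    by auto
  then have "deriv f = f'"
    by (auto simp: DERIV_imp_deriv)
  with f' show "differentiable_upto k (deriv f)" by simp
qed

lemma smooth_isCont: "smooth f \<Longrightarrow> isCont f x"
  using smooth_has_deriv DERIV_isCont by blast

lemma smooth_iff: "smooth f \<longleftrightarrow> (\<forall>k x. ((deriv ^^ k) f) differentiable (at x))"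
proof
  assume f: "smooth f"
  have "smooth ((deriv ^^ k) f)" for k
    by (induction k) (use f smooth_deriv in auto)
  then show "\<forall>k x. ((deriv ^^ k) f) differentiable (at x)"
    using smooth_has_deriv real_differentiable_def by blast
next
  assume f: "\<forall>k x. ((deriv ^^ k) f) differentiable (at x)"
  have "differentiable_upto n g" if "\<forall>k x. ((deriv ^^ k) g) differentiable (at x)" for n g
    using that
  proof (induction n arbitrary: g)
    case (Suc n)
    have "\<forall>x. (g has_real_derivative deriv g x) (at x)"
      using Suc.prems[rule_format, of 0] DERIV_deriv_iff_real_differentiable by auto
    moreover have "differentiable_upto n (deriv g)"
      using Suc.prems by (intro Suc.IH) (metis comp_apply funpow_Suc_right)
    ultimately show ?case by auto
  qed simp
  with f show "smooth f" by (simp add: smooth_def)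
qed

section \<open>Test functions and bumps\<close>

lemma test_fun_iff: "test_fun \<psi> \<longleftrightarrow> smooth \<psi> \<and> closure {x. \<psi> x \<noteq> 0} \<subseteq> {0<..<1}"
  by (simp add: test_fun_def smooth_iff)

text \<open>Compact support of one factor is inherited, so a fixed cutoff may be multiplied by a
  primitive of a bump or by an approximant of a Sobolev function.\<close>

lemma test_fun_mult:
  assumes "test_fun \<theta>" "smooth f"
  shows "test_fun (\<lambda>x. \<theta> x * f x)"
  unfolding test_fun_iff
proof
  have "closure {x. \<theta> x * f x \<noteq> 0} \<subseteq> closure {x. \<theta> x \<noteq> 0}"
    by (intro closure_mono) auto
  with assms show "closure {x. \<theta> x * f x \<noteq> 0} \<subseteq> {0<..<1}"
    by (auto simp: test_fun_iff)
qed (use assms in \<open>auto simp: test_fun_iff intro: smooth_mult\<close>)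

text \<open>The parameter serves two purposes: \<epsilon> = 1 gives the spatial cutoff, and
  \<epsilon> tending to 0 approximates the indicator of the open interval.\<close>

definition bump :: "real \<Rightarrow> real \<Rightarrow> real \<Rightarrow> real \<Rightarrow> real" where
  "bump \<epsilon> y z x = (if y < x \<and> x < z then exp (- \<epsilon> / ((x - y) * (z - x))) else 0)"

text \<open>The exponential series of \<epsilon> / t dominates its term of order
  \<open>k + 2\<close>. The order \<open>k\<close> cancels a pole; the two extra orders leave the
  factor t^2 that makes bumps flat at their endpoints.\<close>

lemma exp_minus_inverse_le:
  fixes \<epsilon> t :: real
  assumes "\<epsilon> > 0" "t > 0"
  shows "inverse t ^ k * exp (- \<epsilon> / t) \<le> fact (k + 2) / \<epsilon> ^ (k + 2) * t\<^sup>2"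
proof -
  have pos: "\<epsilon> / t > 0" using assms by simp
  have "(\<epsilon> / t) ^ (k + 2) / fact (k + 2) \<le> exp (\<epsilon> / t)"
  proof -
    have "(\<Sum>n<k+3. (\<epsilon> / t) ^ n / fact n) \<le> exp (\<epsilon> / t)"
      using pos sum_le_suminf[OF summable_exp_generic, of "{..<k+3}" "\<epsilon> / t"]
      by (simp add: exp_def divide_inverse mult.commute scaleR_conv_of_real)
    moreover have "(\<epsilon> / t) ^ (k + 2) / fact (k + 2) \<le> (\<Sum>n<k+3. (\<epsilon> / t) ^ n / fact n)"
      using pos by (intro member_le_sum) auto
    ultimately show ?thesis by linarith
  qed
  moreover have *: "exp (- \<epsilon> / t) \<le> F / A" if "A / F \<le> exp (\<epsilon> / t)" "A > 0" "F > 0" for A F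
    using that by (simp add: exp_minus field_simps)
  moreover have "(\<epsilon> / t) ^ (k + 2) > 0"
    using pos by (rule zero_less_power)
  ultimately have "exp (- \<epsilon> / t) \<le> fact (k + 2) / (\<epsilon> / t) ^ (k + 2)"
    by (intro *) auto
  then have "inverse t ^ k * exp (- \<epsilon> / t) \<le> inverse t ^ k * (fact (k + 2) / (\<epsilon> / t) ^ (k + 2))"
    using assms by (intro mult_left_mono) auto
  also have "\<dots> = fact (k + 2) / \<epsilon> ^ (k + 2) * t\<^sup>2"
    using assms by (simp add: field_simps power2_eq_square del: fact_Suc)
  finally show ?thesis .
qed

text \<open>The bound forces \<open>f c = 0\<close> and makes the difference quotient at most M |x -
  c|. This covers the endpoints of a bump, where no single formula is valid on both sides.\<close>

lemma has_derivative_zero_if_le_square: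
  fixes f :: "real \<Rightarrow> real"
  assumes "\<And>x. \<bar>f x\<bar> \<le> M * (x - c)\<^sup>2"
  shows "(f has_real_derivative 0) (at c)"
proof -
  have "f c = 0" using assms[of c] by simp
  have "((\<lambda>x. M * \<bar>x - c\<bar>) \<longlongrightarrow> 0) (at c)"
    by (auto intro!: tendsto_eq_intros)
  then have "((\<lambda>x. (f x - f c) / (x - c)) \<longlongrightarrow> 0) (at c)"
  proof (rule Lim_null_comparison[rotated])
    show "\<forall>\<^sub>F x in at c. norm ((f x - f c) / (x - c)) \<le> M * \<bar>x - c\<bar>"
      unfolding eventually_at_filter
    proof (rule always_eventually, intro allI impI)
      fix x assume "x \<noteq> c"
      then have "\<bar>f x\<bar> \<le> M * \<bar>x - c\<bar> * \<bar>x - c\<bar>"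
        using assms[of x] by (simp add: power2_eq_square mult.assoc flip: abs_mult)
      then show "norm ((f x - f c) / (x - c)) \<le> M * \<bar>x - c\<bar>"
        using \<open>f c = 0\<close> \<open>x \<noteq> c\<close> by (simp add: pos_divide_le_eq)
    qed
  qed
  then show ?thesis
    by (simp add: has_field_derivative_iff)
qed

text \<open>The derivatives of \<open>bump\<close> stay in the family \<open>P / q ^ k * bump\<close> with \<open>q = (x - y) (z - x)\<close>
  and \<open>P\<close> smooth.\<close>

lemma smooth_mult_bump:
  fixes y z \<epsilon> :: real
  assumes "\<epsilon> > 0" "y < z"
  defines "q \<equiv> \<lambda>x. (x - y) * (z - x)"
  assumes "smooth P"
  shows "smooth (\<lambda>x. P x * (inverse (q x) ^ k * bump \<epsilon> y z x))"
proof -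
  have q: "smooth q"
    unfolding q_def by (intro smooth_mult smooth_diff smooth_ident smooth_const)
  define F where "F = (\<lambda>P k x. P x * (inverse (q x) ^ k * bump \<epsilon> y z x))"
  \<comment> \<open>Differentiating P q^(-k) exp (-\<epsilon> / q) creates poles of order k, k + 1
    and k + 2; all are written over q^(k + 2), with a new smooth numerator
    \<open>?P'\<close>.\<close>
  have deriv_F: "(F P k has_real_derivative
      F (\<lambda>x. deriv P x * (q x * q x) - of_nat k * (P x * (deriv q x * q x)) + \<epsilon> * (P x * deriv q x)) (k + 2) x) (at x)"
    (is "(_ has_real_derivative F ?P' _ _) _") if P: "smooth P" for P k x
  proof -
    consider "y < x \<and> x < z" | "x < y \<or> z < x" | "x = y \<or> x = z"
      by linarith
    then show ?thesis
    proof cases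
      case 1
      then have qx: "q x > 0" by (simp add: q_def)
      note [derivative_intros] = smooth_has_deriv[OF P] smooth_has_deriv[OF q]
      have bump_x: "bump \<epsilon> y z x = exp (- \<epsilon> / q x)"
        using 1 by (simp add: bump_def q_def)
      have "((\<lambda>x. P x * (inverse (q x) ^ k * exp (- \<epsilon> / q x))) has_real_derivative F ?P' (k + 2) x) (at x)"
        unfolding F_def bump_x
        by (cases k; rule derivative_eq_intros refl | use qx in \<open>simp add: field_simps power2_eq_square\<close>)+
      moreover have "\<forall>\<^sub>F u in nhds x. F P k u = P u * (inverse (q u) ^ k * exp (- \<epsilon> / q u))"
        using eventually_nhds_in_open[of "{y<..<z}" x] 1
        by (auto elim!: eventually_mono simp: F_def bump_def q_def)
      ultimately show ?thesis
        using DERIV_cong_ev[of x x "F P k" "\<lambda>u. P u * (inverse (q u) ^ k * exp (- \<epsilon> / q u))"]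
        by simp
    next
      case 2
      then have x: "x \<in> {..<y} \<union> {z<..}" by auto
      have "\<forall>\<^sub>F u in nhds x. F P k u = 0"
        using eventually_nhds_in_open[OF open_Un[OF open_lessThan open_greaterThan] x] by (auto elim!: eventually_mono simp: F_def bump_def)
      moreover have "F ?P' (k + 2) x = 0" using 2 by (auto simp: F_def bump_def)
      ultimately show ?thesis
        using DERIV_cong_ev[of x x "F P k" "\<lambda>x. 0"] by simp
    next
      case 3
      have "compact (P ` {y..z})"
        by (intro compact_continuous_image continuous_at_imp_continuous_on) (auto simp: smooth_isCont P)
      then obtain B where B: "\<And>u. u \<in> {y..z} \<Longrightarrow> \<bar>P u\<bar> \<le> B"
        by (metis compact_imp_bounded bounded_real imageI)
      define M where "M = B * (fact (k + 2) / \<epsilon> ^ (k + 2) * (z - y)\<^sup>2)"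
      have B0: "B \<ge> 0" using B[of y] \<open>y < z\<close> by auto
      have "\<bar>F P k u\<bar> \<le> M * (u - x)\<^sup>2" for u
      proof (cases "y < u \<and> u < z")
        case True
        then have qu: "q u > 0" by (simp add: q_def)
        \<comment> \<open>One factor of \<open>q u\<close> is the distance to the endpoint
          \<open>x\<close>, the other is at most z - y. A bound by q^2 thus becomes a bound by (u -
          x)^2.\<close>
        have "q u \<le> (z - y) * \<bar>u - x\<bar>"
          using 3
        proof
          assume "x = y"
          then show ?thesis
            using True mult_left_mono[of "z - u" "z - y" "u - y"] by (simp add: q_def mult.commute)
        next
          assume "x = z"
          then show ?thesis
            using True mult_right_mono[of "u - y" "z - y" "z - u"] by (simp add: q_def)
        qed
        then have "(q u)\<^sup>2 \<le> ((z - y) * \<bar>u - x\<bar>)\<^sup>2"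
          using qu by (intro power_mono) auto
        then have q2: "(q u)\<^sup>2 \<le> (z - y)\<^sup>2 * (u - x)\<^sup>2"
          by (simp add: power_mult_distrib)
        have "\<bar>F P k u\<bar> = \<bar>P u\<bar> * (inverse (q u) ^ k * exp (- \<epsilon> / q u))"
          using True qu by (simp add: F_def bump_def q_def abs_mult)
        also have "\<dots> \<le> B * (fact (k + 2) / \<epsilon> ^ (k + 2) * (q u)\<^sup>2)"
          using B[of u] True B0 qu assms(1) by (intro mult_mono exp_minus_inverse_le) auto
        also have "\<dots> \<le> B * (fact (k + 2) / \<epsilon> ^ (k + 2) * ((z - y)\<^sup>2 * (u - x)\<^sup>2))"
          using B0 assms(1) by (intro mult_left_mono q2) auto
        finally show ?thesis by (simp only: M_def mult.assoc)
      next
        case False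
        then have "F P k u = 0" by (auto simp: F_def bump_def)
        moreover have "0 \<le> M" using B0 assms(1) by (auto simp: M_def)
        ultimately show ?thesis by simp
      qed
      then have "(F P k has_real_derivative 0) (at x)"
        by (rule has_derivative_zero_if_le_square)
      moreover have "F ?P' (k + 2) x = 0" using 3 by (auto simp: F_def bump_def)
      ultimately show ?thesis by simp
    qed
  qed
  \<comment> \<open>The induction ranges over all \<open>P\<close> and \<open>k\<close>, since
    differentiation changes the numerator and raises the order of the pole by two.\<close>
  have "differentiable_upto n (F P k)" if "smooth P" for n P k
    using that
  proof (induction n arbitrary: P k)
    case (Suc n)
    have "smooth (\<lambda>x. deriv P x * (q x * q x) - of_nat k * (P x * (deriv q x * q x)) + \<epsilon> * (P x * deriv q x))"
      by (intro smooth_add smooth_diff smooth_mult smooth_const smooth_deriv q Suc.prems)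
    from Suc.IH[OF this] deriv_F[OF Suc.prems] show ?case
      unfolding differentiable_upto.simps by blast
  qed simp
  with \<open>smooth P\<close> show ?thesis
    unfolding smooth_def F_def by blast
qed

lemma smooth_bump: "\<epsilon> > 0 \<Longrightarrow> y < z \<Longrightarrow> smooth (bump \<epsilon> y z)"
  using smooth_mult_bump[OF _ _ smooth_const, of \<epsilon> y z 1 0] by simp

lemma test_fun_bump:
  assumes "\<epsilon> > 0" "0 < y" "y < z" "z < 1"
  shows "test_fun (bump \<epsilon> y z)"
proof -
  have "closure {x. bump \<epsilon> y z x \<noteq> 0} \<subseteq> {y..z}"
    by (intro closure_minimal) (auto simp: bump_def split: if_splits)
  then show ?thesis
    using assms by (auto simp: test_fun_iff smooth_bump)
qed

lemma bump_bounds: "\<epsilon> > 0 \<Longrightarrow> 0 \<le> bump \<epsilon> y z x \<and> bump \<epsilon> y z x \<le> 1"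
  by (auto simp: bump_def)

subsection \<open>Almost everywhere bounds from integrals over intervals\<close>

text \<open>Distinct members meet only in endpoints, a null set, so integrals add up over finite
  subfamilies; continuity along increasing unions reaches the countable family.\<close>

lemma set_integral_Union_intervals_nonneg:
  fixes f :: "real \<Rightarrow> real"
  assumes f: "integrable lebesgue f"
    and nonneg: "\<And>K. K \<in> \<D> \<Longrightarrow> 0 \<le> (LINT x:K|lebesgue. f x)"
    and D: "countable \<D>" "\<And>K. K \<in> \<D> \<Longrightarrow> \<exists>c d. c < d \<and> K = {c..d}"
      "pairwise (\<lambda>A B. interior A \<inter> interior B = {}) \<D>"
  shows "0 \<le> (LINT x:(\<Union>\<D>)|lebesgue. f x)"
proof (cases "\<D> = {}")
  case False
  define A where "A = from_nat_into \<D>"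
  have A: "A i \<in> \<D>" for i
    using False by (simp add: A_def from_nat_into)
  have UN_A: "(\<Union>n. \<Union>i\<le>n. A i) = \<Union>\<D>"
    using D(1) False by (auto simp: A_def intro: from_nat_into dest: from_nat_into_surj)
  have sets_D: "K \<in> sets lebesgue" if "K \<in> \<D>" for K
    using D(2)[OF that] by auto
  have set_int: "set_integrable lebesgue B f" if "B \<in> sets lebesgue" for B
    using integrable_mult_indicator[OF that f] by (simp add: set_integrable_def)
  have fin: "0 \<le> (LINT x:(\<Union>i\<le>n. A i)|lebesgue. f x)" for n
  proof -
    have "(LINT x:(\<Union>K\<in>A ` {..n}. K)|lebesgue. f x) = (\<Sum>K\<in>A ` {..n}. LINT x:K|lebesgue. f x)"
    proof (rule set_integral_finite_UN_AE)
      fix K L assume "K \<in> A ` {..n}" "L \<in> A ` {..n}"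
      then have KL: "K \<in> \<D>" "L \<in> \<D>" using A by auto
      obtain c d where K: "K = {c..d}" using D(2)[OF KL(1)] by auto
      obtain c' d' where L: "L = {c'..d'}" using D(2)[OF KL(2)] by auto
      \<comment> \<open>Away from the four endpoints, a common point would be interior to both
        intervals.\<close>
      have "negligible {c, d, c', d'}" by simp
      then have "AE x in lebesgue. x \<notin> {c, d, c', d'}"
        by (intro AE_not_in) (simp add: negligible_iff_null_sets)
      then show "AE x in lebesgue. x \<in> K \<and> x \<in> L \<longrightarrow> K = L"
      proof eventually_elim
        case (elim x)
        show ?case
        proof (intro impI, rule ccontr)
          assume x: "x \<in> K \<and> x \<in> L" and "K \<noteq> L"
          then have "interior K \<inter> interior L = {}"
            using D(3) KL by (auto simp: pairwise_def)
          moreover have "x \<in> interior K \<inter> interior L"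
            using x elim by (auto simp: K L)
          ultimately show False by blast
        qed
      qed
    qed (use A sets_D set_int in auto)
    moreover have "0 \<le> (LINT x:K|lebesgue. f x)" if "K \<in> A ` {..n}" for K
      using A that nonneg by auto
    ultimately show ?thesis
      by (simp add: sum_nonneg)
  qed
  have "(\<lambda>n. LINT x:(\<Union>i\<le>n. A i)|lebesgue. f x) \<longlonglongrightarrow> (LINT x:(\<Union>n. \<Union>i\<le>n. A i)|lebesgue. f x)"
  proof (rule set_integral_cont_up)
    show "incseq (\<lambda>n. \<Union>i\<le>n. A i)" by (auto simp: incseq_def intro: order_trans)
    show "set_integrable lebesgue (\<Union>n. \<Union>i\<le>n. A i) f"
      by (intro set_int sets.countable_UN sets.finite_UN) (use A sets_D in auto)
  qed (use A sets_D in auto)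
  then show ?thesis
    using fin by (simp add: UN_A LIMSEQ_le_const)
qed (simp add: set_lebesgue_integral_def)

text \<open>The set \<open>S\<close> of negative values is covered from outside by non-overlapping
  intervals with small excess measure. The integral over each cover is nonnegative, hence in the
  limit so is that over \<open>S\<close>; as \<open>f < 0\<close> on \<open>S\<close>, this set is
  null.\<close>

lemma AE_nonneg_if_interval_integrals_nonneg:
  fixes f :: "real \<Rightarrow> real"
  assumes f: "integrable lebesgue f"
    and nonneg: "\<And>c d. y \<le> c \<Longrightarrow> c < d \<Longrightarrow> d \<le> z \<Longrightarrow> 0 \<le> (LINT x:{c..d}|lebesgue. f x)"
    and "y < z"
  shows "AE x in lebesgue. x \<in> {y..z} \<longrightarrow> 0 \<le> f x"
proof -
  have [measurable]: "f \<in> borel_measurable lebesgue" using f by auto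
  define S where "S = {x \<in> space lebesgue. x \<in> {y..z} \<and> f x < 0}"
  have S[measurable]: "S \<in> sets lebesgue"
  proof -
    have "{x \<in> space lebesgue. f x < 0} \<in> sets lebesgue"
      using f by (intro borel_measurable_less) auto
    moreover have "S = {y..z} \<inter> {x \<in> space lebesgue. f x < 0}"
      by (auto simp: S_def)
    ultimately show ?thesis by auto
  qed
  have lm: "S \<in> lmeasurable"
    by (rule fmeasurableI2[OF _ _ S, of "{y..z}"]) (auto simp: S_def)
  have Syz: "S \<subseteq> cbox y z" by (auto simp: S_def)
  have "\<exists>\<D>. S \<subseteq> \<Union>\<D> \<and> \<Union>\<D> \<in> lmeasurable \<and> measure lebesgue (\<Union>\<D>) \<le> measure lebesgue S + (1/2)^n
      \<and> 0 \<le> (LINT x:(\<Union>\<D>)|lebesgue. f x)" for n :: nat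
  proof (rule measurable_outer_intervals_bounded[OF lm Syz, of "(1/2)^n"])
    fix \<D> :: "real set set"
    assume D: "countable \<D>" "\<And>K. K \<in> \<D> \<Longrightarrow> K \<subseteq> cbox y z \<and> K \<noteq> {} \<and> (\<exists>c d. K = cbox c d)"
      "pairwise (\<lambda>A B. interior A \<inter> interior B = {}) \<D>"
      "\<And>K. \<lbrakk>K \<in> \<D>; box y z \<noteq> {}\<rbrakk> \<Longrightarrow> interior K \<noteq> {}"
      "S \<subseteq> \<Union>\<D>" "\<Union>\<D> \<in> lmeasurable" "measure lebesgue (\<Union>\<D>) \<le> measure lebesgue S + (1/2)^n"
    have K: "\<exists>c d. y \<le> c \<and> c < d \<and> d \<le> z \<and> K = {c..d}" if "K \<in> \<D>" for K
    proof -
      from D(2)[OF that] obtain c d where K: "K = {c..d}" by auto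
      moreover have "interior K \<noteq> {}"
        using D(4)[OF that] \<open>y < z\<close> by auto
      moreover have "K \<subseteq> {y..z}"
        using D(2)[OF that] by auto
      ultimately show ?thesis
        by (intro exI[of _ c] exI[of _ d]) auto
    qed
    have "0 \<le> (LINT x:(\<Union>\<D>)|lebesgue. f x)"
      by (rule set_integral_Union_intervals_nonneg[OF f _ D(1) _ D(3)]) (use K nonneg in blast)+
    with D(5-7) show ?thesis by blast
  qed auto
  then obtain \<D> where D: "\<And>n. S \<subseteq> \<Union>(\<D> n)" "\<And>n. \<Union>(\<D> n) \<in> lmeasurable"
    "\<And>n. measure lebesgue (\<Union>(\<D> n)) \<le> measure lebesgue S + (1/2)^n"
    "\<And>n. 0 \<le> (LINT x:(\<Union>(\<D> n))|lebesgue. f x)"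
    by metis
  define T where "T n = \<Union>(\<D> n)" for n :: nat
  have T[measurable]: "T n \<in> sets lebesgue" for n
    using D(2) by (auto simp: T_def fmeasurableD)
  have diff: "T n - S \<in> lmeasurable" "measure lebesgue (T n - S) \<le> (1/2)^n" for n
    using D(2) lm measurable_measure_Diff[of "T n" lebesgue S] D(1,3)[of n]
    by (auto simp: T_def fmeasurable_Diff fmeasurableD)
  \<comment> \<open>The excess measures are at most (1/2)^n, a summable sequence, so almost every
    point lies in only finitely many sets \<open>T n - S\<close>: the indicators of
    \<open>T n\<close> converge almost everywhere to that of \<open>S\<close>.\<close>
  have "AE x in lebesgue. \<forall>\<^sub>F n in sequentially. x \<in> space lebesgue - (T n - S)"
  proof (rule borel_cantelli_AE1)
    show "emeasure lebesgue (T n - S) < \<infinity>" for n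
      using diff(1)[of n] by (auto simp: fmeasurable_def)
    show "summable (\<lambda>n. measure lebesgue (T n - S))"
      by (rule summable_comparison_test'[OF summable_geometric[of "1/2::real"]]) (use diff in auto)
  qed auto
  then have lim: "AE x in lebesgue. (\<lambda>n. indicator (T n) x *\<^sub>R f x) \<longlonglongrightarrow> indicator S x *\<^sub>R f x"
  proof eventually_elim
    case (elim x)
    show ?case
      by (rule tendsto_eventually, use elim in eventually_elim)
         (use D(1) in \<open>auto simp: T_def indicator_def\<close>)
  qed
  have "(\<lambda>n. LINT x:T n|lebesgue. f x) \<longlonglongrightarrow> (LINT x:S|lebesgue. f x)"
    unfolding set_lebesgue_integral_def
    by (rule integral_dominated_convergence[where w = "\<lambda>x. \<bar>f x\<bar>", OF _ _ _ lim])
       (use f in \<open>auto simp: indicator_def\<close>)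
  then have "0 \<le> (LINT x:S|lebesgue. f x)"
    using D(4) by (auto simp: T_def intro: LIMSEQ_le_const)
  then have "(\<integral>x. - (indicator S x * f x) \<partial>lebesgue) \<le> 0"
    by (simp add: set_lebesgue_integral_def)
  moreover have nn: "0 \<le> - (indicator S x * f x)" for x
    by (auto simp: S_def indicator_def)
  moreover have "0 \<le> (\<integral>x. - (indicator S x * f x) \<partial>lebesgue)"
    by (rule Bochner_Integration.integral_nonneg) (rule nn)
  ultimately have "(\<integral>x. - (indicator S x * f x) \<partial>lebesgue) = 0"
    by linarith
  moreover have "integrable lebesgue (\<lambda>x. - (indicator S x * f x))"
    using integrable_mult_indicator[OF S f] by simp
  ultimately have "AE x in lebesgue. - (indicator S x * f x) = 0"
    using nn by (subst (asm) integral_nonneg_eq_0_iff_AE) auto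
  then show ?thesis
    by eventually_elim (auto simp: S_def indicator_def split: if_splits)
qed

section \<open>Integrability on the unit interval of products with bounded or continuous
  factors\<close>

lemma integrable_mult_bounded_AE:
  fixes f g :: "'a \<Rightarrow> real"
  assumes f: "integrable M f" and g[measurable]: "g \<in> borel_measurable M"
    and bound: "AE x in M. \<bar>g x\<bar> \<le> B"
  shows "integrable M (\<lambda>x. g x * f x)"
proof (rule Bochner_Integration.integrable_bound[where f = "\<lambda>x. B * f x"])
  show "AE x in M. norm (g x * f x) \<le> norm (B * f x)"
    using bound by eventually_elim (auto simp: abs_mult intro!: mult_right_mono)
qed (use f in auto)

lemma borel_measurable_I01_if_isCont:
  assumes "\<And>x. isCont g x"
  shows "g \<in> borel_measurable I01"
  by (rule continuous_imp_measurable_on_sets_lebesgue)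
     (use assms in \<open>auto simp: continuous_at_imp_continuous_on\<close>)

lemma isCont_bounded_01:
  fixes g :: "real \<Rightarrow> real"
  assumes "\<And>x. isCont g x"
  obtains B where "B \<ge> 0" "\<And>x. x \<in> {0..1} \<Longrightarrow> \<bar>g x\<bar> \<le> B"
proof -
  have "compact (g ` {0..1})"
    by (intro compact_continuous_image continuous_at_imp_continuous_on) (use assms in auto)
  then obtain B where "\<forall>x \<in> {0..1}. \<bar>g x\<bar> \<le> B"
    by (metis compact_imp_bounded bounded_real imageI)
  then show thesis
    using that[of "max B 0"] by force
qed

lemma integrable_I01_mult_isCont:
  fixes g :: "real \<Rightarrow> real"
  assumes f: "integrable I01 f" and g: "\<And>x. isCont g x"
  shows "integrable I01 (\<lambda>x. g x * f x)"
proof -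
  obtain B where "\<And>x. x \<in> {0..1} \<Longrightarrow> \<bar>g x\<bar> \<le> B"
    using isCont_bounded_01[of g] g by blast
  then have "AE x in I01. \<bar>g x\<bar> \<le> B"
    by (intro AE_I2) auto
  then show ?thesis
    by (intro integrable_mult_bounded_AE[OF f] borel_measurable_I01_if_isCont g)
qed

lemma AE_I01_iff: "(AE x in I01. P x) \<longleftrightarrow> (AE x in lebesgue. x \<in> {0<..<1} \<longrightarrow> P x)"
  by (subst AE_restrict_space_iff) auto

lemma finite_measure_I01: "finite_measure I01"
  by (rule finite_measure_lebesgue_on) simp

text \<open>A primitive whose slope lies in [0,1] on (c,d) and is 0 elsewhere varies by at most d -
  c; normalising it to vanish at \<open>c\<close> turns this into a bound on its values.\<close>

lemma bump_antiderivative: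
  assumes "\<epsilon> > 0" "c < d"
  obtains \<Psi> where "\<And>x. (\<Psi> has_real_derivative bump \<epsilon> c d x) (at x)" "\<And>x. \<bar>\<Psi> x\<bar> \<le> d - c"
proof -
  have "\<exists>F. \<forall>x. -\<infinity> < ereal x \<longrightarrow> ereal x < \<infinity> \<longrightarrow> (F has_vector_derivative bump \<epsilon> c d x) (at x)"
    by (rule einterval_antiderivative) (use assms in \<open>auto intro!: smooth_isCont smooth_bump\<close>)
  then obtain F where F: "\<And>x. (F has_real_derivative bump \<epsilon> c d x) (at x)"
    by (auto simp: has_real_derivative_iff_has_vector_derivative)
  have const: "F u = F v" if "u \<le> v" "\<And>x. u < x \<Longrightarrow> x < v \<Longrightarrow> bump \<epsilon> c d x = 0" for u v
  proof (cases "u = v")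
    case False
    then obtain \<xi> where "u < \<xi>" "\<xi> < v" "F v - F u = (v - u) * bump \<epsilon> c d \<xi>"
      using MVT2[of u v F "bump \<epsilon> c d"] F \<open>u \<le> v\<close> by force
    with that(2) show ?thesis by simp
  qed simp
  have diff: "\<bar>F x - F c\<bar> \<le> d - c" for x
  proof (cases "x \<le> c")
    case True
    then have "F x = F c"
      by (intro const) (auto simp: bump_def)
    with assms show ?thesis by simp
  next
    case False
    \<comment> \<open>The primitive is constant to the right of \<open>d\<close>, so only the
      increment from \<open>c\<close> to \<open>m\<close>, of length at most d - c, matters.\<close>
    define m where "m = min x d"
    have m: "c < m" "m \<le> d" "m \<le> x" using False assms by (auto simp: m_def)
    have "F m = F x"
      using m by (intro const) (auto simp: bump_def m_def)
    moreover obtain \<xi> where "F m - F c = (m - c) * bump \<epsilon> c d \<xi>"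
      using MVT2[of c m F "bump \<epsilon> c d"] F m by blast
    moreover have "0 \<le> (m - c) * bump \<epsilon> c d \<xi>"
      using m bump_bounds[OF assms(1)] by auto
    moreover have "(m - c) * bump \<epsilon> c d \<xi> \<le> (d - c) * 1"
      by (rule mult_mono) (use m bump_bounds[OF assms(1)] in auto)
    ultimately show ?thesis by simp
  qed
  show thesis
    by (rule that[of "\<lambda>x. F x - F c"]) (use F diff in \<open>auto intro!: derivative_eq_intros\<close>)
qed

text \<open>Inside (c,d) the exponent tends to 0. With \<open>bump_bounds\<close>, dominated
  convergence carries estimates from bumps over to open intervals.\<close>

lemma tendsto_bump: "(\<lambda>n. bump (1 / real (Suc n)) c d x) \<longlonglongrightarrow> indicator {c<..<d} x"
proof (cases "c < x \<and> x < d")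
  case True
  have "(\<lambda>n. - (1 / real (Suc n)) / ((x - c) * (d - x))) \<longlonglongrightarrow> - 0 / ((x - c) * (d - x))"
    by (intro tendsto_intros LIMSEQ_inverse_real_of_nat[unfolded inverse_eq_divide]) (use True in auto)
  from tendsto_exp[OF this] True show ?thesis by (simp add: bump_def)
next
  case False
  then have "bump (1 / real (Suc n)) c d x = 0" for n by (auto simp: bump_def)
  with False show ?thesis by (auto simp: indicator_def)
qed

text \<open>Testing with \<open>\<theta> \<Psi>\<close>, where \<open>\<Psi>\<close> is a primitive of a bump approximating the indicator of \<open>(c,d)\<close>,
  bounds the integral of \<open>\<theta> w\<close> over \<open>(c,d)\<close> by a multiple of \<open>d - c\<close>.\<close>

lemma test_fun_mult_bounded:
  assumes w: "integrable I01 w" and h: "integrable I01 h"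
    and weak: "\<And>\<psi>. test_fun \<psi> \<Longrightarrow> (\<integral>x. w x * deriv \<psi> x \<partial>I01) = - (\<integral>x. h x * \<psi> x \<partial>I01)"
    and \<theta>: "test_fun \<theta>"
  shows "\<exists>B. AE x in I01. \<bar>\<theta> x * w x\<bar> \<le> B"
proof -
  have sm: "smooth \<theta>" using \<theta> by (simp add: test_fun_iff)
  note cont = smooth_isCont[OF sm] smooth_isCont[OF smooth_deriv[OF sm]]
  have w\<theta>: "integrable I01 (\<lambda>x. \<theta> x * w x)" and w\<theta>': "integrable I01 (\<lambda>x. deriv \<theta> x * w x)"
    and h\<theta>: "integrable I01 (\<lambda>x. \<theta> x * h x)"
    using integrable_I01_mult_isCont w h cont by blast+
  \<comment> \<open>These are the L1 norms of the two terms left over when the product rule for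
    \<theta> \<Psi> isolates the bump term.\<close>
  define B where "B = (\<integral>x. \<bar>deriv \<theta> x * w x\<bar> \<partial>I01) + (\<integral>x. \<bar>\<theta> x * h x\<bar> \<partial>I01)"
  have B: "B \<ge> 0" by (simp add: B_def)
  have bump_le: "\<bar>\<integral>x. bump \<epsilon> c d x * (\<theta> x * w x) \<partial>I01\<bar> \<le> B * (d - c)" if "\<epsilon> > 0" "c < d" for \<epsilon> c d
  proof -
    obtain \<Psi> where \<Psi>: "\<And>x. (\<Psi> has_real_derivative bump \<epsilon> c d x) (at x)" "\<And>x. \<bar>\<Psi> x\<bar> \<le> d - c"
      using bump_antiderivative[OF \<open>\<epsilon> > 0\<close> \<open>c < d\<close>] by blast
    have \<Psi>sm: "smooth \<Psi>" and bsm: "smooth (bump \<epsilon> c d)"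
      using smooth_if_has_smooth_derivative[OF \<Psi>(1)] smooth_bump[OF that] by auto
    have int: "integrable I01 (\<lambda>x. \<Psi> x * (deriv \<theta> x * w x))" "integrable I01 (\<lambda>x. \<Psi> x * (\<theta> x * h x))"
      "integrable I01 (\<lambda>x. bump \<epsilon> c d x * (\<theta> x * w x))"
      using integrable_I01_mult_isCont w\<theta> w\<theta>' h\<theta> smooth_isCont[OF \<Psi>sm] smooth_isCont[OF bsm] by blast+
    have "deriv (\<lambda>x. \<theta> x * \<Psi> x) x = deriv \<theta> x * \<Psi> x + bump \<epsilon> c d x * \<theta> x" for x
      by (rule DERIV_imp_deriv, rule derivative_eq_intros, rule smooth_has_deriv[OF sm], rule \<Psi>) simp
    then have "w x * deriv (\<lambda>x. \<theta> x * \<Psi> x) x = \<Psi> x * (deriv \<theta> x * w x) + bump \<epsilon> c d x * (\<theta> x * w x)" for x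
      by (simp add: algebra_simps)
    then have "(\<integral>x. \<Psi> x * (deriv \<theta> x * w x) \<partial>I01) + (\<integral>x. bump \<epsilon> c d x * (\<theta> x * w x) \<partial>I01)
        = - (\<integral>x. \<Psi> x * (\<theta> x * h x) \<partial>I01)"
      using weak[OF test_fun_mult[OF \<theta> \<Psi>sm]] int by (simp add: mult_ac)
    moreover have "\<bar>\<integral>x. \<Psi> x * g x \<partial>I01\<bar> \<le> (d - c) * (\<integral>x. \<bar>g x\<bar> \<partial>I01)"
      if "integrable I01 g" "integrable I01 (\<lambda>x. \<Psi> x * g x)" for g
    proof -
      have "\<bar>\<integral>x. \<Psi> x * g x \<partial>I01\<bar> \<le> (\<integral>x. \<bar>\<Psi> x * g x\<bar> \<partial>I01)"
        by (rule integral_abs_bound)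
      also have "\<dots> \<le> (\<integral>x. (d - c) * \<bar>g x\<bar> \<partial>I01)"
        using that \<Psi>(2) by (intro integral_mono integrable_abs integrable_mult_right)
          (auto simp: abs_mult intro!: mult_right_mono)
      finally show ?thesis by simp
    qed
    from this[OF w\<theta>' int(1)] this[OF h\<theta> int(2)] 
    have "\<bar>\<integral>x. \<Psi> x * (deriv \<theta> x * w x) \<partial>I01\<bar> + \<bar>\<integral>x. \<Psi> x * (\<theta> x * h x) \<partial>I01\<bar> \<le> B * (d - c)"
      by (simp add: B_def algebra_simps)
    ultimately show ?thesis by linarith
  qed
  \<comment> \<open>\<open>B\<close> does not depend on \<epsilon>, so the bound survives the limit
    \<epsilon> = 1 / (n + 1) to 0, with |\<theta> w| as dominating function.\<close>
  have le: "\<bar>\<integral>x. indicator {c<..<d} x * (\<theta> x * w x) \<partial>I01\<bar> \<le> B * (d - c)" if "c < d" for c d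
  proof -
    have "(\<lambda>n. \<integral>x. bump (1 / real (Suc n)) c d x * (\<theta> x * w x) \<partial>I01)
        \<longlonglongrightarrow> (\<integral>x. indicator {c<..<d} x * (\<theta> x * w x) \<partial>I01)"
    proof (rule integral_dominated_convergence[where w = "\<lambda>x. \<bar>\<theta> x * w x\<bar>"])
      show "(\<lambda>x. indicator {c<..<d} x * (\<theta> x * w x)) \<in> borel_measurable I01"
        by (rule borel_measurable_times[OF _ borel_measurable_integrable[OF w\<theta>]])
           (rule measurable_restrict_space1, rule borel_measurable_indicator, simp)
      show "(\<lambda>x. bump (1 / real (Suc n)) c d x * (\<theta> x * w x)) \<in> borel_measurable I01" for n
        using that by (intro borel_measurable_times[OF _ borel_measurable_integrable[OF w\<theta>]]
            borel_measurable_I01_if_isCont smooth_isCont smooth_bump) auto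
      show "AE x in I01. norm (bump (1 / real (Suc n)) c d x * (\<theta> x * w x)) \<le> \<bar>\<theta> x * w x\<bar>" for n
        using bump_bounds[of "1 / real (Suc n)" c d] by (intro AE_I2) (auto simp: abs_mult intro!: mult_left_le_one_le)
      show "AE x in I01. (\<lambda>n. bump (1 / real (Suc n)) c d x * (\<theta> x * w x)) \<longlonglongrightarrow> indicator {c<..<d} x * (\<theta> x * w x)"
        by (intro AE_I2 tendsto_mult tendsto_const tendsto_bump)
    qed (use w\<theta> in auto)
    then show ?thesis
      using bump_le[OF _ that] by (intro LIMSEQ_le_const2[OF tendsto_rabs]) auto
  qed
  \<comment> \<open>By \<open>le\<close>, the function B - \<sigma> \<theta> w has nonnegative
    integral over every subinterval, hence is nonnegative almost everywhere. The two signs together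
    bound the absolute value.\<close>
  have one_sided: "AE x in I01. \<sigma> * (\<theta> x * w x) \<le> B" if "\<sigma> = 1 \<or> \<sigma> = - 1" for \<sigma> :: real
  proof -
    define f where "f = (\<lambda>x. indicator {0<..<1} x * (B - \<sigma> * (\<theta> x * w x)))"
    have "integrable I01 (\<lambda>x. B - \<sigma> * (\<theta> x * w x))"
      using w\<theta> by (intro Bochner_Integration.integrable_diff integrable_mult_right
          finite_measure.integrable_const finite_measure_I01)
    then have f: "integrable lebesgue f"
      by (simp add: integrable_restrict_space f_def)
    have "AE x in lebesgue. x \<in> {0..1} \<longrightarrow> 0 \<le> f x"
    proof (rule AE_nonneg_if_interval_integrals_nonneg[OF f])
      fix c d :: real assume cd: "0 \<le> c" "c < d" "d \<le> 1"
      have "negligible {c, d}" by simp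
      then have "AE x in lebesgue. x \<notin> {c, d}"
        by (intro AE_not_in) (simp add: negligible_iff_null_sets)
      then have "(LINT x:{c..d}|lebesgue. f x) = (LINT x:{c<..<d}|lebesgue. f x)"
        unfolding set_lebesgue_integral_def
      proof (intro integral_cong_AE)
        show "AE x in lebesgue. x \<notin> {c, d} \<Longrightarrow>
          AE x in lebesgue. indicator {c..d} x *\<^sub>R f x = indicator {c<..<d} x *\<^sub>R f x"
          by (erule eventually_mono) (auto simp: indicator_def)
      qed (use f integrable_mult_indicator[OF _ f] in \<open>auto intro!: borel_measurable_integrable\<close>)
      also have "\<dots> = (\<integral>x. indicator {c<..<d} x * B - \<sigma> * (indicator {c<..<d} x * (\<theta> x * w x)) \<partial>I01)"
        by (simp add: set_lebesgue_integral_def f_def integral_restrict_space algebra_simps)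
      also have "\<dots> = (d - c) * B - \<sigma> * (\<integral>x. indicator {c<..<d} x * (\<theta> x * w x) \<partial>I01)"
      proof -
        have "measure I01 {c<..<d} = d - c"
          using cd by (subst measure_restrict_space) auto
        moreover have sets: "{c<..<d} \<in> sets I01"
          using cd by (auto simp: sets_restrict_space_iff)
        moreover have "integrable I01 (\<lambda>x. indicator {c<..<d} x * (\<theta> x * w x))"
          using integrable_mult_indicator[OF sets w\<theta>] by simp
        moreover have "integrable I01 (indicator {c<..<d} :: real \<Rightarrow> real)"
          using cd by (intro integrable_real_indicator sets)
            (simp add: finite_measure.emeasure_finite[OF finite_measure_I01] less_top[symmetric])
        ultimately show ?thesis
          using cd by (simp add: Int_absorb2)
      qed
      also have "\<dots> \<ge> 0"
        using le[OF cd(2)] that by (auto simp: mult.commute)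
      finally show "0 \<le> (LINT x:{c..d}|lebesgue. f x)" .
    qed simp
    then show ?thesis
      by (auto simp: AE_I01_iff f_def elim!: eventually_mono)
  qed
  have "AE x in I01. \<theta> x * w x \<le> B" "AE x in I01. - (\<theta> x * w x) \<le> B"
    using one_sided[of 1] one_sided[of "-1"] by auto
  then have "AE x in I01. \<bar>\<theta> x * w x\<bar> \<le> B"
    by eventually_elim linarith
  then show ?thesis by blast
qed

subsection \<open>Integration by parts against Sobolev functions\<close>

lemma integrable_I01_if_isCont:
  fixes f :: "real \<Rightarrow> real"
  assumes "\<And>x. isCont f x"
  shows "integrable I01 f"
  using integrable_I01_mult_isCont[of "\<lambda>x. 1" f] assms finite_measure_I01
  by (simp add: finite_measure.integrable_const)

text \<open>The fundamental theorem of calculus, started at 0. For smooth functions this is the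
  embedding of \<open>W110\<close> into the bounded functions.\<close>

lemma smooth_le_integral_deriv:
  assumes f: "smooth f" "f 0 = 0" and x: "x \<in> {0..1}"
  shows "\<bar>f x\<bar> \<le> (\<integral>x. \<bar>deriv f x\<bar> \<partial>I01)"
proof -
  note cont = smooth_isCont[OF smooth_deriv[OF f(1)]]
  have c: "continuous_on S (deriv f)" "continuous_on S (\<lambda>x. \<bar>deriv f x\<bar>)" for S
    using cont by (auto intro!: continuous_at_imp_continuous_on continuous_rabs)
  have "(deriv f has_integral f x - f 0) {0..x}"
    using x smooth_has_deriv[OF f(1)]
    by (intro fundamental_theorem_of_calculus)
       (auto simp: has_real_derivative_iff_has_vector_derivative intro: has_vector_derivative_at_within)
  then have "\<bar>f x\<bar> = norm (integral {0..x} (deriv f))"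
    using f(2) by (simp add: integral_unique)
  also have "\<dots> \<le> integral {0..x} (\<lambda>x. \<bar>deriv f x\<bar>)"
    by (intro integral_norm_bound_integral integrable_continuous_real c) auto
  also have "\<dots> \<le> integral {0..1} (\<lambda>x. \<bar>deriv f x\<bar>)"
    using x by (intro integral_subset_le integrable_continuous_real c) auto
  also have "\<dots> = integral {0<..<1} (\<lambda>x. \<bar>deriv f x\<bar>)"
    by (simp add: integral_open_interval_real)
  also have "\<dots> = (\<integral>x. \<bar>deriv f x\<bar> \<partial>I01)"
    by (intro lebesgue_integral_eq_integral[symmetric] integrable_I01_if_isCont) (auto simp: cont)
  finally show ?thesis .
qed

section \<open>Uniform approximation of \<open>W110\<close> functions by test functions\<close>

lemma has_weak_deriv_wderiv: "u \<in> Sobolev1 X \<Longrightarrow> has_weak_deriv u (wderiv u)"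
  unfolding Sobolev1_def wderiv_def by (auto intro: someI_ex[of "has_weak_deriv u"])

lemma W110_integrable:
  assumes "u \<in> W110"
  shows "integrable I01 u" "integrable I01 (wderiv u)"
  using assms by (auto simp: W110_def Sobolev1_def L1_def)

lemma test_fun_0: "test_fun \<psi> \<Longrightarrow> \<psi> 0 = 0"
  using closure_subset[of "{x. \<psi> x \<noteq> 0}"] by (auto simp: test_fun_iff)

text \<open>Two approximants differ on [0,1] by at most \<open>\<delta> n + \<delta> m\<close>;
  letting \<open>m\<close> run along an almost everywhere convergent subsequence replaces the second
  one by \<open>u\<close>. The same \<open>\<delta> n\<close> is the L1 distance of the derivatives,
  so one sequence controls both errors.\<close>

lemma W110_approx:
  assumes u: "u \<in> W110"
  obtains \<psi> \<delta> where "\<And>n. test_fun (\<psi> n)" "\<And>n. AE x in I01. \<bar>u x - \<psi> n x\<bar> \<le> \<delta> n" "\<delta> \<longlonglongrightarrow> 0"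
    "\<And>n. \<delta> n = (\<integral>x. \<bar>wderiv u x - deriv (\<psi> n) x\<bar> \<partial>I01)"
proof -
  obtain \<psi> :: "nat \<Rightarrow> real \<Rightarrow> real" where \<psi>: "\<And>n. test_fun (\<psi> n)" and
    lim: "(\<lambda>n. (\<integral>x. \<bar>u x - \<psi> n x\<bar> \<partial>I01) + (\<integral>x. \<bar>wderiv u x - deriv (\<psi> n) x\<bar> \<partial>I01)) \<longlonglongrightarrow> 0"
    using u by (auto simp: W110_def)
  define \<delta> where "\<delta> n = (\<integral>x. \<bar>wderiv u x - deriv (\<psi> n) x\<bar> \<partial>I01)" for n
  have \<psi>sm: "smooth (\<psi> n)" for n using \<psi> by (simp add: test_fun_iff)
  note cont = smooth_isCont[OF \<psi>sm] smooth_isCont[OF smooth_deriv[OF \<psi>sm]]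
  note int = integrable_I01_if_isCont[OF cont(1)] integrable_I01_if_isCont[OF cont(2)]
  note intu = W110_integrable[OF u]
  have \<delta>: "\<delta> \<longlonglongrightarrow> 0"
    by (rule tendsto_sandwich[OF _ _ tendsto_const lim]) (auto simp: \<delta>_def)
  have "(\<lambda>n. \<integral>x. norm (u x - \<psi> n x) \<partial>I01) \<longlonglongrightarrow> 0"
    by (rule tendsto_sandwich[OF _ _ tendsto_const lim]) auto
  \<comment> \<open>Convergence in L1 gives almost everywhere convergence along a subsequence only.
    This suffices, because \<open>r\<close> is the running index while \<open>n\<close> stays
    fixed.\<close>
  then obtain r :: "nat \<Rightarrow> nat" where r: "strict_mono r" "AE x in I01. (\<lambda>n. u x - \<psi> (r n) x) \<longlonglongrightarrow> 0"
    using tendsto_L1_AE_subseq[of I01 "\<lambda>n x. u x - \<psi> n x"] int intu by auto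
  have diff: "\<bar>\<psi> n x - \<psi> m x\<bar> \<le> \<delta> n + \<delta> m" if "x \<in> {0..1}" for n m x
  proof -
    have d: "deriv (\<lambda>x. \<psi> n x - \<psi> m x) x = deriv (\<psi> n) x - deriv (\<psi> m) x" for x
      by (intro DERIV_imp_deriv DERIV_diff smooth_has_deriv \<psi>sm)
    have "\<bar>\<psi> n x - \<psi> m x\<bar> \<le> (\<integral>x. \<bar>deriv (\<psi> n) x - deriv (\<psi> m) x\<bar> \<partial>I01)"
      using smooth_le_integral_deriv[OF smooth_diff[OF \<psi>sm \<psi>sm] _ that, of n m] \<psi>
      by (simp add: test_fun_0 d)
    also have "\<dots> \<le> (\<integral>x. \<bar>wderiv u x - deriv (\<psi> n) x\<bar> + \<bar>wderiv u x - deriv (\<psi> m) x\<bar> \<partial>I01)"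
      by (intro integral_mono integrable_abs Bochner_Integration.integrable_add
          Bochner_Integration.integrable_diff int intu) auto
    also have "\<dots> = \<delta> n + \<delta> m"
      unfolding \<delta>_def
      by (intro Bochner_Integration.integral_add integrable_abs Bochner_Integration.integrable_diff int intu)
    finally show ?thesis .
  qed
  have "AE x in I01. \<bar>u x - \<psi> n x\<bar> \<le> \<delta> n" for n
    using r(2) AE_space
  proof eventually_elim
    case (elim x)
    have "(\<lambda>k. u x - \<psi> (r k) x) \<longlonglongrightarrow> 0" by (rule elim)
    from tendsto_diff[OF tendsto_const this, of "u x - \<psi> n x"]
    have "(\<lambda>k. \<psi> (r k) x - \<psi> n x) \<longlonglongrightarrow> u x - \<psi> n x" by simp
    moreover have "(\<lambda>k. \<delta> (r k) + \<delta> n) \<longlonglongrightarrow> 0 + \<delta> n"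
      using LIMSEQ_subseq_LIMSEQ[OF \<delta> r(1)] by (intro tendsto_add tendsto_const) (simp add: comp_def)
    ultimately show ?case
      using elim diff by (intro LIMSEQ_le[OF tendsto_rabs, of _ _ _ "0 + \<delta> n", simplified]) auto
  qed
  from that[OF \<psi> this \<delta> \<delta>_def] show thesis .
qed

text \<open>A single approximant suffices: it is continuous, hence bounded on [0,1], and within
  \<open>\<delta> 0\<close> of \<open>u\<close> almost everywhere.\<close>

lemma W110_bounded:
  assumes "u \<in> W110"
  shows "\<exists>B. AE x in I01. \<bar>u x\<bar> \<le> B"
proof -
  obtain \<psi> :: "nat \<Rightarrow> real \<Rightarrow> real" and \<delta>
    where \<psi>: "\<And>n. test_fun (\<psi> n)" "\<And>n. AE x in I01. \<bar>u x - \<psi> n x\<bar> \<le> \<delta> n"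
    using W110_approx[OF assms] by metis
  obtain B where "\<And>x. x \<in> {0..1} \<Longrightarrow> \<bar>\<psi> (0::nat) x\<bar> \<le> B"
    using isCont_bounded_01[of "\<psi> 0"] \<psi>(1) smooth_isCont test_fun_iff by metis
  then have "AE x in I01. \<bar>\<psi> 0 x\<bar> \<le> B" by (intro AE_I2) auto
  with \<psi>(2)[of 0] have "AE x in I01. \<bar>u x\<bar> \<le> B + \<delta> 0"
    by eventually_elim linarith
  then show ?thesis by blast
qed

lemma integrable_mult_W110:
  assumes "u \<in> W110" "integrable I01 f"
  shows "integrable I01 (\<lambda>x. u x * f x)"
  using W110_bounded[OF assms(1)] W110_integrable[OF assms(1)] integrable_mult_bounded_AE[OF assms(2)]
  by blast

lemma integral_abs_mult_le:
  fixes f g :: "'a \<Rightarrow> real"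
  assumes f: "integrable M f" and g: "g \<in> borel_measurable M" and bound: "AE x in M. \<bar>g x\<bar> \<le> B"
  shows "\<bar>\<integral>x. g x * f x \<partial>M\<bar> \<le> B * (\<integral>x. \<bar>f x\<bar> \<partial>M)"
proof -
  have "\<bar>\<integral>x. g x * f x \<partial>M\<bar> \<le> (\<integral>x. \<bar>g x * f x\<bar> \<partial>M)"
    by (rule integral_abs_bound)
  also have "\<dots> \<le> (\<integral>x. B * \<bar>f x\<bar> \<partial>M)"
    using bound f by (intro integral_mono_AE integrable_abs integrable_mult_bounded_AE[OF f g bound])
      (auto elim!: eventually_mono simp: abs_mult intro!: mult_right_mono)
  finally show ?thesis by simp
qed

text \<open>The weak equation is tested with \<theta> \<psi> n. Terms containing \<psi> n itself
  converge because \<psi> n tends to \<open>u\<close> uniformly; the derivatives converge only in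
  L1, and there the boundedness of \<theta> w gives both the limit and the integrability of its
  product with \<open>wderiv u\<close>.\<close>

lemma W110_integration_by_parts:
  assumes u: "u \<in> W110" and w: "integrable I01 w" and h: "integrable I01 h"
    and weak: "\<And>\<psi>. test_fun \<psi> \<Longrightarrow> (\<integral>x. w x * deriv \<psi> x \<partial>I01) = - (\<integral>x. h x * \<psi> x \<partial>I01)"
    and \<theta>: "test_fun \<theta>"
  shows "integrable I01 (\<lambda>x. wderiv u x * (\<theta> x * w x))"
    and "(\<integral>x. u x * (deriv \<theta> x * w x) \<partial>I01) + (\<integral>x. wderiv u x * (\<theta> x * w x) \<partial>I01)
      = - (\<integral>x. u x * (\<theta> x * h x) \<partial>I01)"
proof -
  have sm: "smooth \<theta>" using \<theta> by (simp add: test_fun_iff)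
  note cont = smooth_isCont[OF sm] smooth_isCont[OF smooth_deriv[OF sm]]
  have w\<theta>: "integrable I01 (\<lambda>x. \<theta> x * w x)" and w\<theta>': "integrable I01 (\<lambda>x. deriv \<theta> x * w x)"
    and h\<theta>: "integrable I01 (\<lambda>x. \<theta> x * h x)"
    using integrable_I01_mult_isCont w h cont by blast+
  obtain B where B: "AE x in I01. \<bar>\<theta> x * w x\<bar> \<le> B"
    using test_fun_mult_bounded[OF w h weak \<theta>] by blast
  obtain \<psi> \<delta> where \<psi>: "\<And>n. test_fun (\<psi> n)" "\<And>n. AE x in I01. \<bar>u x - \<psi> n x\<bar> \<le> \<delta> n" "\<delta> \<longlonglongrightarrow> 0"
    "\<And>n. \<delta> n = (\<integral>x. \<bar>wderiv u x - deriv (\<psi> n) x\<bar> \<partial>I01)"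
    by (rule W110_approx[OF u]) (rule that)
  have \<psi>sm: "smooth (\<psi> n)" for n using \<psi> by (simp add: test_fun_iff)
  note \<psi>cont = smooth_isCont[OF \<psi>sm] smooth_isCont[OF smooth_deriv[OF \<psi>sm]]
  note int\<psi> = integrable_I01_if_isCont[OF \<psi>cont(1)] integrable_I01_if_isCont[OF \<psi>cont(2)]
  note intu = W110_integrable[OF u]
  note meas = borel_measurable_integrable
  have lim: "(\<lambda>n. \<integral>x. \<psi> n x * f x \<partial>I01) \<longlonglongrightarrow> (\<integral>x. u x * f x \<partial>I01)" if f: "integrable I01 f" for f
  proof (rule LIM_zero_cancel, rule Lim_null_comparison)
    have "norm ((\<integral>x. \<psi> n x * f x \<partial>I01) - (\<integral>x. u x * f x \<partial>I01)) \<le> \<delta> n * (\<integral>x. \<bar>f x\<bar> \<partial>I01)" for n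
    proof -
      have "(\<integral>x. \<psi> n x * f x \<partial>I01) - (\<integral>x. u x * f x \<partial>I01) = - (\<integral>x. (u x - \<psi> n x) * f x \<partial>I01)"
        using integrable_I01_mult_isCont[OF f \<psi>cont(1)] integrable_mult_W110[OF u f]
        by (simp add: left_diff_distrib)
      then show ?thesis
        using integral_abs_mult_le[OF f _ \<psi>(2), of n] meas[OF Bochner_Integration.integrable_diff[OF intu(1) int\<psi>(1)]]
        by simp
    qed
    then show "\<forall>\<^sub>F n in sequentially. norm ((\<integral>x. \<psi> n x * f x \<partial>I01) - (\<integral>x. u x * f x \<partial>I01))
        \<le> \<delta> n * (\<integral>x. \<bar>f x\<bar> \<partial>I01)" by simp
    show "(\<lambda>n. \<delta> n * (\<integral>x. \<bar>f x\<bar> \<partial>I01)) \<longlonglongrightarrow> 0"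
      using tendsto_mult_right[OF \<psi>(3)] by simp
  qed
  show int: "integrable I01 (\<lambda>x. wderiv u x * (\<theta> x * w x))"
    using integrable_mult_bounded_AE[OF intu(2) meas[OF w\<theta>] B] by (simp add: mult.commute)
  have lim': "(\<lambda>n. \<integral>x. deriv (\<psi> n) x * (\<theta> x * w x) \<partial>I01) \<longlonglongrightarrow> (\<integral>x. wderiv u x * (\<theta> x * w x) \<partial>I01)"
  proof (rule LIM_zero_cancel, rule Lim_null_comparison)
    have "norm ((\<integral>x. deriv (\<psi> n) x * (\<theta> x * w x) \<partial>I01) - (\<integral>x. wderiv u x * (\<theta> x * w x) \<partial>I01)) \<le> B * \<delta> n" for n
    proof -
      have "(\<integral>x. deriv (\<psi> n) x * (\<theta> x * w x) \<partial>I01) - (\<integral>x. wderiv u x * (\<theta> x * w x) \<partial>I01)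
          = - (\<integral>x. (\<theta> x * w x) * (wderiv u x - deriv (\<psi> n) x) \<partial>I01)"
        using integrable_I01_mult_isCont[OF w\<theta> \<psi>cont(2)] int
        by (simp add: right_diff_distrib mult.commute)
      then show ?thesis
        using integral_abs_mult_le[OF Bochner_Integration.integrable_diff[OF intu(2) int\<psi>(2)] meas[OF w\<theta>] B, of n]
        by (simp add: \<psi>(4))
    qed
    then show "\<forall>\<^sub>F n in sequentially. norm ((\<integral>x. deriv (\<psi> n) x * (\<theta> x * w x) \<partial>I01)
        - (\<integral>x. wderiv u x * (\<theta> x * w x) \<partial>I01)) \<le> B * \<delta> n" by simp
    show "(\<lambda>n. B * \<delta> n) \<longlonglongrightarrow> 0"
      using tendsto_mult_left[OF \<psi>(3)] by simp
  qed
  have eq: "(\<integral>x. \<psi> n x * (deriv \<theta> x * w x) \<partial>I01) + (\<integral>x. deriv (\<psi> n) x * (\<theta> x * w x) \<partial>I01)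
      = - (\<integral>x. \<psi> n x * (\<theta> x * h x) \<partial>I01)" for n
  proof -
    have "deriv (\<lambda>x. \<theta> x * \<psi> n x) x = deriv \<theta> x * \<psi> n x + deriv (\<psi> n) x * \<theta> x" for x
      by (intro DERIV_imp_deriv DERIV_mult smooth_has_deriv sm \<psi>sm)
    then have "w x * deriv (\<lambda>x. \<theta> x * \<psi> n x) x = \<psi> n x * (deriv \<theta> x * w x) + deriv (\<psi> n) x * (\<theta> x * w x)" for x
      by (simp add: algebra_simps)
    then show ?thesis
      using weak[OF test_fun_mult[OF \<theta> \<psi>sm], of n] integrable_I01_mult_isCont[OF w\<theta>' \<psi>cont(1)]
        integrable_I01_mult_isCont[OF w\<theta> \<psi>cont(2)] by (simp add: mult_ac)
  qed
  show "(\<integral>x. u x * (deriv \<theta> x * w x) \<partial>I01) + (\<integral>x. wderiv u x * (\<theta> x * w x) \<partial>I01)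
      = - (\<integral>x. u x * (\<theta> x * h x) \<partial>I01)"
    by (rule LIMSEQ_unique[OF tendsto_add[OF lim[OF w\<theta>'] lim'], unfolded eq]) (rule tendsto_minus[OF lim[OF h\<theta>]])
qed

subsection \<open>The energy inequality\<close>

text \<open>A bump is nonnegative, so each point where it vanishes is a global minimum and therefore
  critical. The radius 1 is arbitrary.\<close>

lemma deriv_bump_outside:
  assumes "\<epsilon> > 0" "y < z" "x \<notin> {y..z}"
  shows "deriv (bump \<epsilon> y z) x = 0"
  by (rule DERIV_local_min[OF smooth_has_deriv[OF smooth_bump[OF assms(1,2)]], of 1])
     (use assms bump_bounds[OF assms(1)] in \<open>auto simp: bump_def\<close>)

text \<open>Expanding (|f| - 1)^2 \<ge> 0 yields |f| \<le> 1 + f^2, and constants are integrable on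
  (0,1).\<close>

lemma L2_imp_integrable:
  assumes "f \<in> L2"
  shows "integrable I01 f"
proof (rule Bochner_Integration.integrable_bound[where f = "\<lambda>x. 1 + (f x)\<^sup>2"])
  show "AE x in I01. norm (f x) \<le> norm (1 + (f x)\<^sup>2)"
  proof (intro AE_I2)
    fix x
    have "0 \<le> (\<bar>f x\<bar> - 1)\<^sup>2" "0 \<le> (f x)\<^sup>2" by simp_all
    then show "norm (f x) \<le> norm (1 + (f x)\<^sup>2)"
      by (simp add: power2_eq_square algebra_simps)
  qed
qed (use assms in \<open>auto simp: L2_def intro!: finite_measure.integrable_const finite_measure_I01\<close>)

text \<open>Here \<open>u\<close> stands for a solution at a fixed time and \<open>v\<close> for its
  time derivative. After testing with \<theta>^2 u, the potential is controlled by the lower bound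
  of \<open>b\<close> on [y,z], and Young's inequality absorbs half of the energy. \<open>M\<close>
  is chosen before \<open>u\<close> and \<open>v\<close>, so it serves all times and all
  solutions.\<close>

lemma energy_inequality:
  fixes a b :: "real \<Rightarrow> real"
  assumes cont: "continuous_on {0..1} a" "continuous_on {0..1} b"
    and nonneg: "\<And>x. x \<in> {0..1} \<Longrightarrow> 0 \<le> a x"
    and pos: "\<And>x. x \<in> {y..z} \<Longrightarrow> 0 < b x"
    and yz: "0 < y" "y < z" "z < 1"
  defines "\<theta> \<equiv> bump 1 y z"
  obtains M where "M \<ge> 0" "\<And>u v. u \<in> H2ab a b lam \<Longrightarrow> v \<in> L2 \<Longrightarrow> AE x in I01. v x + opA a b lam u x = 0 \<Longrightarrow>
      integrable I01 (\<lambda>x. (\<theta> x)\<^sup>2 * a x * (wderiv u x)\<^sup>2) \<and>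
      (\<integral>x. (\<theta> x)\<^sup>2 * a x * (wderiv u x)\<^sup>2 \<partial>I01)
        \<le> 2 * (\<integral>x. (\<theta> x)\<^sup>2 * (u x * v x) \<partial>I01) + M * (\<integral>x. indicator {y..z} x * (u x)\<^sup>2 \<partial>I01)"
proof -
  have \<theta>: "test_fun \<theta>"
    unfolding \<theta>_def using yz by (intro test_fun_bump) auto
  then have sm: "smooth \<theta>" by (simp add: test_fun_iff)
  obtain D where D: "\<And>x. x \<in> {0..1} \<Longrightarrow> \<bar>deriv \<theta> x\<bar> \<le> D"
    using isCont_bounded_01[of "deriv \<theta>"] smooth_isCont[OF smooth_deriv[OF sm]] by metis
  have "bounded (a ` {0..1})"
    using cont by (intro compact_imp_bounded compact_continuous_image) auto
  then obtain A where A: "\<And>x. x \<in> {0..1} \<Longrightarrow> \<bar>a x\<bar> \<le> A"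
    by (metis bounded_real imageI)
  have "\<exists>x\<in>{y..z}. \<forall>u\<in>{y..z}. b x \<le> b u"
    using yz by (intro continuous_attains_inf continuous_on_subset[OF cont(2)]) auto
  then obtain \<beta> where \<beta>: "\<beta> > 0" "\<And>x. x \<in> {y..z} \<Longrightarrow> \<beta> \<le> b x"
    using pos by blast
  \<comment> \<open>Young's inequality contributes 2 D^2 A and the potential |lam| / \<beta>; the
    outer factor 2 comes from absorbing half of the energy.\<close>
  define M where "M = 2 * (2 * D\<^sup>2 * A + \<bar>lam\<bar> / \<beta>)"
  have M: "M \<ge> 0"
    using A[of 0] \<beta>(1) by (simp add: M_def)
  \<comment> \<open>This is the coefficient of u^2 after Young's inequality. Both \<theta> and its
    derivative vanish outside [y,z], hence the indicator.\<close>
  have coeff: "2 * (deriv \<theta> x)\<^sup>2 * a x + (\<theta> x)\<^sup>2 * (lam / b x) \<le> M / 2 * indicator {y..z} x"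
    if "x \<in> {0..1}" for x
  proof (cases "x \<in> {y..z}")
    case True
    have "(deriv \<theta> x)\<^sup>2 \<le> D\<^sup>2"
      using power_mono[OF D[OF that], of 2] by simp
    then have "(deriv \<theta> x)\<^sup>2 * a x \<le> D\<^sup>2 * A"
      using A[OF that] nonneg[OF that] by (intro mult_mono) auto
    moreover have "(\<theta> x)\<^sup>2 * (lam / b x) \<le> 1 * (\<bar>lam\<bar> / \<beta>)"
    proof -
      have "lam / b x \<le> \<bar>lam\<bar> / \<beta>"
        using \<beta>(1) \<beta>(2)[OF True] by (intro frac_le) auto
      then have "(\<theta> x)\<^sup>2 * (lam / b x) \<le> (\<theta> x)\<^sup>2 * (\<bar>lam\<bar> / \<beta>)"
        by (intro mult_left_mono) auto
      also have "\<dots> \<le> 1 * (\<bar>lam\<bar> / \<beta>)"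
        using \<beta>(1) bump_bounds[of 1 y z x] by (intro mult_right_mono power_le_one) (auto simp: \<theta>_def)
      finally show ?thesis .
    qed
    moreover have "M / 2 = 2 * (D\<^sup>2 * A) + \<bar>lam\<bar> / \<beta>"
      by (simp add: M_def)
    moreover have "indicator {y..z} x = (1 :: real)"
      using True by simp
    ultimately show ?thesis
      by (simp only: mult.assoc mult_1_right mult_1_left)
  next
    case False
    then have "deriv \<theta> x = 0" "\<theta> x = 0"
      using yz deriv_bump_outside[of 1 y z x] by (auto simp: \<theta>_def bump_def)
    with False show ?thesis by simp
  qed
  show thesis
  proof (rule that[OF M])
    fix u v assume u: "u \<in> H2ab a b lam" and v: "v \<in> L2" and eq: "AE x in I01. v x + opA a b lam u x = 0"
    define g where "g = wderiv u"
    define w where "w = (\<lambda>x. a x * g x)"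
    define h where "h = wderiv w"
    have uW: "u \<in> W110" and wH: "w \<in> H1"
      using u by (auto simp: H2ab_def H1a_def w_def g_def)
    have w: "integrable I01 w" and h: "integrable I01 h"
      using wH by (auto simp: Sobolev1_def h_def intro: L2_imp_integrable)
    have weak: "(\<integral>x. w x * deriv \<psi> x \<partial>I01) = - (\<integral>x. h x * \<psi> x \<partial>I01)" if "test_fun \<psi>" for \<psi>
      using has_weak_deriv_wderiv[OF wH] that by (simp add: has_weak_deriv_def h_def)
    have \<theta>2: "test_fun (\<lambda>x. \<theta> x * \<theta> x)"
      by (rule test_fun_mult[OF \<theta> sm])
    then have sm2: "smooth (\<lambda>x. \<theta> x * \<theta> x)" by (simp add: test_fun_iff)
    have d\<theta>2: "deriv (\<lambda>x. \<theta> x * \<theta> x) x = 2 * \<theta> x * deriv \<theta> x" for x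
      using DERIV_imp_deriv[OF DERIV_mult[OF smooth_has_deriv[OF sm] smooth_has_deriv[OF sm]]]
      by (simp add: mult.commute)
    note ibp = W110_integration_by_parts[OF uW w h weak \<theta>2, folded g_def]
    have E_eq: "g x * (\<theta> x * \<theta> x * w x) = (\<theta> x)\<^sup>2 * a x * (wderiv u x)\<^sup>2" for x
      by (simp add: w_def g_def power2_eq_square)
    have int: "integrable I01 (\<lambda>x. (\<theta> x)\<^sup>2 * a x * (wderiv u x)\<^sup>2)"
      using ibp(1) unfolding E_eq .
    have int1: "integrable I01 (\<lambda>x. u x * (deriv (\<lambda>x. \<theta> x * \<theta> x) x * w x))"
      by (intro integrable_mult_W110[OF uW] integrable_I01_mult_isCont w smooth_isCont smooth_deriv sm2)
    have int2: "integrable I01 (\<lambda>x. u x * (\<theta> x * \<theta> x * h x))"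
      by (intro integrable_mult_W110[OF uW] integrable_I01_mult_isCont[OF h] smooth_isCont sm2)
    have int3: "integrable I01 (\<lambda>x. (\<theta> x)\<^sup>2 * (u x * v x))"
      unfolding power2_eq_square
      by (intro integrable_I01_mult_isCont integrable_mult_W110[OF uW] L2_imp_integrable v smooth_isCont sm2)
    have "integrable I01 (\<lambda>x. u x * u x)"
      by (rule integrable_mult_W110[OF uW W110_integrable(1)[OF uW]])
    moreover have sets_yz: "{y..z} \<in> sets I01"
      using yz by (auto simp: sets_restrict_space_iff)
    ultimately have int4: "integrable I01 (\<lambda>x. indicator {y..z} x * (u x)\<^sup>2)"
      using integrable_mult_indicator[OF sets_yz, of "\<lambda>x. u x * u x"]
      by (simp add: power2_eq_square)
    define E where "E = (\<integral>x. (\<theta> x)\<^sup>2 * a x * (wderiv u x)\<^sup>2 \<partial>I01)"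
    have "E = (\<integral>x. - (u x * (deriv (\<lambda>x. \<theta> x * \<theta> x) x * w x)) - u x * (\<theta> x * \<theta> x * h x) \<partial>I01)"
      using ibp(2) int1 int2 by (simp add: E_eq E_def)
    also have "\<dots> \<le> (\<integral>x. 1/2 * ((\<theta> x)\<^sup>2 * a x * (wderiv u x)\<^sup>2) + (\<theta> x)\<^sup>2 * (u x * v x)
        + M / 2 * (indicator {y..z} x * (u x)\<^sup>2) \<partial>I01)"
    proof (intro integral_mono_AE Bochner_Integration.integrable_diff Bochner_Integration.integrable_minus
        Bochner_Integration.integrable_add integrable_mult_right int int1 int2 int3 int4)
      show "AE x in I01. - (u x * (deriv (\<lambda>x. \<theta> x * \<theta> x) x * w x)) - u x * (\<theta> x * \<theta> x * h x)
        \<le> 1/2 * ((\<theta> x)\<^sup>2 * a x * (wderiv u x)\<^sup>2) + (\<theta> x)\<^sup>2 * (u x * v x)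
        + M / 2 * (indicator {y..z} x * (u x)\<^sup>2)"
        using eq AE_space
      proof eventually_elim
        case (elim x)
        then have x: "x \<in> {0..1}" by auto
        define L where "L = lam / b x"
        define N where "N = M / 2"
        have h_eq: "h x = - v x - L * u x"
          using elim by (simp add: opA_def h_def w_def g_def L_def)
        \<comment> \<open>Young's inequality as a single square: the factor 2 is chosen so that,
          after halving, exactly half of the energy density appears.\<close>
        have "0 \<le> a x * (\<theta> x * g x + 2 * deriv \<theta> x * u x)\<^sup>2"
          using nonneg[OF x] by simp
        then have young: "- (u x * (2 * \<theta> x * deriv \<theta> x * (a x * g x)))
            \<le> 1/2 * ((\<theta> x)\<^sup>2 * a x * (g x)\<^sup>2) + 2 * (deriv \<theta> x)\<^sup>2 * a x * (u x)\<^sup>2"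
          by (simp add: power2_eq_square algebra_simps)
        have "(2 * (deriv \<theta> x)\<^sup>2 * a x + (\<theta> x)\<^sup>2 * L) * (u x)\<^sup>2 \<le> N * indicator {y..z} x * (u x)\<^sup>2"
          unfolding L_def N_def by (intro mult_right_mono coeff x) simp
        with young show ?case
          unfolding d\<theta>2 h_eq w_def g_def[symmetric] N_def[symmetric]
          by (simp add: power2_eq_square algebra_simps)
      qed
    qed
    also have "\<dots> = 1/2 * E + (\<integral>x. (\<theta> x)\<^sup>2 * (u x * v x) \<partial>I01)
        + M / 2 * (\<integral>x. indicator {y..z} x * (u x)\<^sup>2 \<partial>I01)"
      using int int3 int4 by (simp add: E_def)
    finally show "integrable I01 (\<lambda>x. (\<theta> x)\<^sup>2 * a x * (wderiv u x)\<^sup>2) \<and>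
      (\<integral>x. (\<theta> x)\<^sup>2 * a x * (wderiv u x)\<^sup>2 \<partial>I01)
        \<le> 2 * (\<integral>x. (\<theta> x)\<^sup>2 * (u x * v x) \<partial>I01) + M * (\<integral>x. indicator {y..z} x * (u x)\<^sup>2 \<partial>I01)"
      using int by (simp add: E_def)
  qed
qed

subsection \<open>Differentiation of weighted energies in time\<close>

lemma L2_integrable_mult:
  assumes "f \<in> L2" "g \<in> L2"
  shows "integrable I01 (\<lambda>x. f x * g x)"
proof (rule Bochner_Integration.integrable_bound[where f = "\<lambda>x. (f x)\<^sup>2 + (g x)\<^sup>2"])
  show "AE x in I01. norm (f x * g x) \<le> norm ((f x)\<^sup>2 + (g x)\<^sup>2)"
  proof (intro AE_I2)
    fix x
    have "0 \<le> (\<bar>f x\<bar> - \<bar>g x\<bar>)\<^sup>2" by simp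
    then have "2 * \<bar>f x * g x\<bar> \<le> (f x)\<^sup>2 + (g x)\<^sup>2"
      by (simp add: power2_diff abs_mult)
    then show "norm (f x * g x) \<le> norm ((f x)\<^sup>2 + (g x)\<^sup>2)"
      using abs_ge_zero[of "f x * g x"] unfolding real_norm_def by linarith
  qed
qed (use assms in \<open>auto simp: L2_def\<close>)

lemma L2_add: "f \<in> L2 \<Longrightarrow> g \<in> L2 \<Longrightarrow> (\<lambda>x. f x + g x) \<in> L2"
  using L2_integrable_mult[of f g]
  by (auto simp: L2_def power2_sum mult.assoc)

lemma L2_cmult: "f \<in> L2 \<Longrightarrow> (\<lambda>x. c * f x) \<in> L2"
  by (auto simp: L2_def power_mult_distrib)

lemma L2_diff: "f \<in> L2 \<Longrightarrow> g \<in> L2 \<Longrightarrow> (\<lambda>x. f x - g x) \<in> L2"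
  using L2_add[OF _ L2_cmult, of f g "-1"] by simp

text \<open>The integral of (f - t g)^2 is a nonnegative quadratic polynomial in t, evaluated at its
  minimiser P / G. If G = 0 it is affine, which forces P = 0.\<close>

lemma L2_Cauchy_Schwarz:
  assumes f: "f \<in> L2" and g: "g \<in> L2"
  shows "\<bar>\<integral>x. f x * g x \<partial>I01\<bar> \<le> L2norm f * L2norm g"
proof -
  define F G P where "F = (\<integral>x. (f x)\<^sup>2 \<partial>I01)" and "G = (\<integral>x. (g x)\<^sup>2 \<partial>I01)" and "P = (\<integral>x. f x * g x \<partial>I01)"
  have int: "integrable I01 (\<lambda>x. (f x)\<^sup>2)" "integrable I01 (\<lambda>x. (g x)\<^sup>2)" "integrable I01 (\<lambda>x. f x * g x)"
    using f g L2_integrable_mult by (auto simp: L2_def)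
  have quad: "0 \<le> F - 2 * t * P + t\<^sup>2 * G" for t
  proof -
    have "0 \<le> (\<integral>x. (f x - t * g x)\<^sup>2 \<partial>I01)"
      by simp
    also have "(\<lambda>x. (f x - t * g x)\<^sup>2) = (\<lambda>x. (f x)\<^sup>2 - 2 * t * (f x * g x) + t\<^sup>2 * (g x)\<^sup>2)"
      by (auto simp: power2_eq_square algebra_simps)
    finally show ?thesis
      using int by (simp add: F_def G_def P_def)
  qed
  have "P\<^sup>2 \<le> F * G"
  proof (cases "G = 0")
    case True
    have "P = 0"
    proof (rule ccontr)
      assume "P \<noteq> 0"
      \<comment> \<open>For G = 0 this value of t makes the polynomial equal to -1.\<close>
      with quad[of "(F + 1) / (2 * P)"] True show False by simp
    qed
    with True show ?thesis by simp
  next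
    case False
    then have "G > 0" by (simp add: G_def order_less_le)
    with quad[of "P / G"] show ?thesis
      by (simp add: power2_eq_square field_simps)
  qed
  then have "sqrt (P\<^sup>2) \<le> sqrt (F * G)"
    by (rule real_sqrt_le_mono)
  then show ?thesis
    by (simp add: L2norm_def F_def G_def P_def real_sqrt_mult)
qed

lemma integral_weight_mult_le:
  assumes f: "f \<in> L2" and g: "g \<in> L2"
    and p: "p \<in> borel_measurable I01" "\<And>x. x \<in> {0<..<1} \<Longrightarrow> \<bar>p x\<bar> \<le> P" "0 \<le> P"
  shows "integrable I01 (\<lambda>x. p x * (f x * g x))"
    and "\<bar>\<integral>x. p x * (f x * g x) \<partial>I01\<bar> \<le> P * (L2norm f * L2norm g)"
proof -
  have bound: "AE x in I01. \<bar>p x\<bar> \<le> P"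
    using p(2) by (intro AE_I2) auto
  note int = L2_integrable_mult[OF f g]
  show "integrable I01 (\<lambda>x. p x * (f x * g x))"
    by (rule integrable_mult_bounded_AE[OF int p(1) bound])
  have abs: "(\<lambda>x. \<bar>f x\<bar>) \<in> L2" "(\<lambda>x. \<bar>g x\<bar>) \<in> L2"
    using f g by (auto simp: L2_def)
  have "\<bar>\<integral>x. p x * (f x * g x) \<partial>I01\<bar> \<le> P * (\<integral>x. \<bar>f x * g x\<bar> \<partial>I01)"
    by (rule integral_abs_mult_le[OF int p(1) bound])
  also have "\<dots> \<le> P * (L2norm f * L2norm g)"
    using L2_Cauchy_Schwarz[OF abs] p(3) by (intro mult_left_mono) (auto simp: abs_mult L2norm_def)
  finally show "\<bar>\<integral>x. p x * (f x * g x) \<partial>I01\<bar> \<le> P * (L2norm f * L2norm g)" .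
qed

text \<open>The error of the difference quotient splits into products of \<open>e\<close>, the error
  in the quotient of \<open>v\<close>, and \<open>d\<close>, the increment of \<open>v\<close>. Both
  tend to 0 in L2, and Cauchy-Schwarz bounds the products. Bounded measurable weights admit both
  \<theta>^2 and an indicator.\<close>

lemma has_derivative_weighted_energy:
  assumes der: "has_L2_derivative_on S v vt" and cont: "L2_continuous_on S v" and t: "t \<in> S"
    and p: "p \<in> borel_measurable I01" "\<And>x. x \<in> {0<..<1} \<Longrightarrow> \<bar>p x\<bar> \<le> P"
  shows "((\<lambda>r. \<integral>x. p x * (v r x)\<^sup>2 \<partial>I01) has_real_derivative
    2 * (\<integral>x. p x * (v t x * vt t x) \<partial>I01)) (at t within S)"
proof -
  have P: "0 \<le> P" using p(2)[of "1/2"] by auto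
  have vL2: "v r \<in> L2" "vt r \<in> L2" if "r \<in> S" for r
    using der that by (auto simp: has_L2_derivative_on_def)
  define F where "F r = (\<integral>x. p x * (v r x)\<^sup>2 \<partial>I01)" for r
  define e d where "e r x = (v r x - v t x) / (r - t) - vt t x" and "d r x = v r x - v t x" for r x
  have e0: "((\<lambda>r. L2norm (e r)) \<longlongrightarrow> 0) (at t within S)" and d0: "((\<lambda>r. L2norm (d r)) \<longlongrightarrow> 0) (at t within S)"
    using der cont t by (auto simp: has_L2_derivative_on_def L2_continuous_on_def e_def[abs_def] d_def[abs_def])
  have quotient: "norm ((F r - F t) / (r - t) - 2 * (\<integral>x. p x * (v t x * vt t x) \<partial>I01))
      \<le> P * (L2norm (e r) * L2norm (d r)) + 2 * (P * (L2norm (e r) * L2norm (v t))) + P * (L2norm (vt t) * L2norm (d r))"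
    if r: "r \<in> S" "r \<noteq> t" for r
  proof -
    have dL2: "d r \<in> L2"
      unfolding d_def[abs_def] using vL2 r t by (intro L2_diff) auto
    have "(\<lambda>x. 1 / (r - t) * d r x - vt t x) \<in> L2"
      using vL2 t by (intro L2_diff L2_cmult dL2) auto
    then have eL2: "e r \<in> L2"
      by (simp add: e_def[abs_def] d_def)
    note le = integral_weight_mult_le[OF _ _ p P]
    have int: "integrable I01 (\<lambda>x. p x * (v s x)\<^sup>2)" if "s \<in> S" for s
      using le(1)[OF vL2(1) vL2(1), of s s] that by (simp add: power2_eq_square)
    have "(F r - F t) / (r - t) - 2 * (\<integral>x. p x * (v t x * vt t x) \<partial>I01)
        = (\<integral>x. (p x * (v r x)\<^sup>2 - p x * (v t x)\<^sup>2) / (r - t) - 2 * (p x * (v t x * vt t x)) \<partial>I01)"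
      using int r t le(1)[OF vL2(1) vL2(2), of t t] by (simp add: F_def)
    \<comment> \<open>The quotient of \<open>v\<close> is e + vt, so that of its square is (e + vt)
      (d + 2 v); subtracting 2 v vt leaves three products, each with a factor tending to 0.\<close>
    also have "\<dots> = (\<integral>x. p x * (e r x * d r x) + 2 * (p x * (e r x * v t x)) + p x * (vt t x * d r x) \<partial>I01)"
    proof (rule Bochner_Integration.integral_cong[OF refl])
      fix x
      define q where "q = 1 / (r - t)"
      have q: "(r - t) * q = 1" using r by (simp add: q_def)
      have e_eq: "e r x = q * d r x - vt t x" by (simp add: e_def d_def q_def)
      have "p x * (v r x)\<^sup>2 - p x * (v t x)\<^sup>2 = p x * (d r x * (d r x + 2 * v t x))"
        by (simp add: d_def power2_eq_square algebra_simps)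
      then have q_eq: "(p x * (v r x)\<^sup>2 - p x * (v t x)\<^sup>2) / (r - t) = q * (p x * (d r x * (d r x + 2 * v t x)))"
        by (simp add: q_def)
      show "(p x * (v r x)\<^sup>2 - p x * (v t x)\<^sup>2) / (r - t) - 2 * (p x * (v t x * vt t x))
          = p x * (e r x * d r x) + 2 * (p x * (e r x * v t x)) + p x * (vt t x * d r x)"
        unfolding q_eq e_eq by (simp add: algebra_simps)
    qed
    also have "\<dots> = (\<integral>x. p x * (e r x * d r x) \<partial>I01) + 2 * (\<integral>x. p x * (e r x * v t x) \<partial>I01)
        + (\<integral>x. p x * (vt t x * d r x) \<partial>I01)"
      using le(1)[OF eL2 dL2] le(1)[OF eL2 vL2(1)[OF t]] le(1)[OF vL2(2)[OF t] dL2] by simp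
    finally show ?thesis
      using le(2)[OF eL2 dL2] le(2)[OF eL2 vL2(1)[OF t]] le(2)[OF vL2(2)[OF t] dL2] by simp
  qed
  have "((\<lambda>r. P * (L2norm (e r) * L2norm (d r)) + 2 * (P * (L2norm (e r) * L2norm (v t))) + P * (L2norm (vt t) * L2norm (d r)))
      \<longlongrightarrow> P * (0 * 0) + 2 * (P * (0 * L2norm (v t))) + P * (L2norm (vt t) * 0)) (at t within S)"
    by (intro tendsto_intros e0 d0)
  then have "((\<lambda>r. P * (L2norm (e r) * L2norm (d r)) + 2 * (P * (L2norm (e r) * L2norm (v t))) + P * (L2norm (vt t) * L2norm (d r)))
      \<longlongrightarrow> 0) (at t within S)" by simp
  then have "((\<lambda>r. (F r - F t) / (r - t) - 2 * (\<integral>x. p x * (v t x * vt t x) \<partial>I01)) \<longlongrightarrow> 0) (at t within S)"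
    by (rule Lim_null_comparison[rotated])
       (use quotient in \<open>auto simp: eventually_at_filter\<close>)
  then show ?thesis
    unfolding has_field_derivative_iff F_def[symmetric] by (rule LIM_zero_cancel)
qed

subsection \<open>The Caccioppoli inequality\<close>

text \<open>Integration by parts moves the time derivative from \<open>F\<close> to the weight,
  which vanishes at 0 and \<open>T\<close>; what remains is at most a multiple of \<open>H\<close>.
  \<open>K\<close> is fixed by \<open>T\<close> and \<open>M\<close> alone, while \<open>k\<close>
  is a free factor for the constants of the exponential weight.\<close>

lemma weighted_energy_nn_integral_le:
  fixes T M :: real
  assumes T: "T > 0" and M: "M \<ge> 0"
  shows "\<exists>K>0. \<forall>E F F' H k. k \<ge> 0 \<longrightarrow>
      (\<forall>t\<in>{0..T}. (F has_real_derivative F' t) (at t within {0..T})) \<longrightarrow>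
      continuous_on {0..T} H \<longrightarrow>
      (\<forall>t\<in>{0<..<T}. 0 \<le> E t \<and> E t \<le> F' t + M * H t) \<longrightarrow>
      (\<forall>t\<in>{0..T}. 0 \<le> F t \<and> F t \<le> H t) \<longrightarrow>
      (\<integral>\<^sup>+t\<in>{0<..<T}. ennreal (k * ((t * (T - t)) ^ 4 * E t)) \<partial>lebesgue)
        \<le> ennreal (k * K) * (\<integral>\<^sup>+t\<in>{0<..<T}. ennreal (H t) \<partial>lebesgue)"
proof -
  define \<eta> where "\<eta> = (\<lambda>t. (t * (T - t)) ^ 4)"
  define \<eta>' where "\<eta>' = (\<lambda>t. 4 * (t * (T - t)) ^ 3 * (T - 2 * t))"
  have \<eta>_deriv: "(\<eta> has_real_derivative \<eta>' t) (at t within S)" for t S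
    unfolding \<eta>_def \<eta>'_def by (auto intro!: derivative_eq_intros simp: algebra_simps)
  have cont: "continuous_on S \<eta>" "continuous_on S \<eta>'" for S
    unfolding \<eta>_def \<eta>'_def by (intro continuous_intros)+
  have "bounded (\<eta> ` {0..T})" "bounded (\<eta>' ` {0..T})"
    by (auto intro!: compact_imp_bounded compact_continuous_image cont)
  then obtain D1 D2 where D12: "\<And>t. t \<in> {0..T} \<Longrightarrow> \<bar>\<eta> t\<bar> \<le> D1" "\<And>t. t \<in> {0..T} \<Longrightarrow> \<bar>\<eta>' t\<bar> \<le> D2"
    by (metis bounded_real imageI)
  \<comment> \<open>The added 1 makes \<open>D\<close>, and with it \<open>K\<close>,
    positive.\<close>
  define D where "D = max D1 D2 + 1"
  have D: "\<bar>\<eta> t\<bar> \<le> D" "\<bar>\<eta>' t\<bar> \<le> D" if "t \<in> {0..T}" for t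
    using D12[OF that] by (auto simp: D_def)
  have D_pos: "D > 0"
    using D12(1)[of 0] T by (auto simp: D_def)
  \<comment> \<open>D M bounds the term M \<eta> H, and D bounds the term - \<eta>' F because F
    \<le> H.\<close>
  define K where "K = D * (1 + M)"
  have K: "K > 0" using D_pos M by (simp add: K_def)
  show ?thesis
  proof (intro exI[of _ K] conjI K allI impI)
    fix E F F' H :: "real \<Rightarrow> real" and k :: real
    assume k: "k \<ge> 0"
      and "\<forall>t\<in>{0..T}. (F has_real_derivative F' t) (at t within {0..T})"
      and H: "continuous_on {0..T} H"
      and "\<forall>t\<in>{0<..<T}. 0 \<le> E t \<and> E t \<le> F' t + M * H t"
      and "\<forall>t\<in>{0..T}. 0 \<le> F t \<and> F t \<le> H t"
    then have F: "\<And>t. t \<in> {0..T} \<Longrightarrow> (F has_real_derivative F' t) (at t within {0..T})"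
      and E: "\<And>t. t \<in> {0<..<T} \<Longrightarrow> 0 \<le> E t \<and> E t \<le> F' t + M * H t"
      and FH: "\<And>t. t \<in> {0..T} \<Longrightarrow> 0 \<le> F t \<and> F t \<le> H t"
      by blast+
    have contF: "continuous_on {0..T} F"
      using F by (rule DERIV_continuous_on)
    \<comment> \<open>\<open>R\<close> is what remains of \<eta> (F' + M H) after the exact
      derivative of \<eta> F is removed.\<close>
    define R where "R = (\<lambda>t. M * (\<eta> t * H t) - \<eta>' t * F t)"
    have contR: "continuous_on {0..T} R"
      unfolding R_def by (intro continuous_intros cont H contF)
    \<comment> \<open>\<open>F'\<close> is merely known to be a derivative, so the fundamental
      theorem is used for the Henstock-Kurzweil integral.\<close>
    have "((\<lambda>t. \<eta>' t * F t + F' t * \<eta> t) has_integral \<eta> T * F T - \<eta> 0 * F 0) {0..T}"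
      using T by (intro fundamental_theorem_of_calculus)
        (auto simp flip: has_real_derivative_iff_has_vector_derivative intro!: DERIV_mult \<eta>_deriv F)
    then have "((\<lambda>t. \<eta>' t * F t + F' t * \<eta> t) has_integral 0) {0..T}"
      by (simp add: \<eta>_def)
    from has_integral_add[OF this integrable_integral[OF integrable_continuous_real[OF contR]]]
    have "((\<lambda>t. \<eta> t * (F' t + M * H t)) has_integral integral {0..T} R) {0..T}"
      by (simp add: R_def algebra_simps)
    from has_integral_mult_right[OF this, of k]
    have int: "((\<lambda>t. k * (\<eta> t * (F' t + M * H t))) has_integral k * integral {0..T} R) {0<..<T}"
      by (simp add: has_integral_Icc_iff_Ioo)
    have R_le: "R t \<le> K * H t" if "t \<in> {0..T}" for t
    proof -
      have H0: "0 \<le> H t" using FH[OF that] by linarith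
      have "M * (\<eta> t * H t) \<le> M * (D * H t)"
        using D(1)[OF that] M H0 by (intro mult_left_mono mult_right_mono) auto
      moreover have "- (\<eta>' t) * F t \<le> D * H t"
        using D(2)[OF that] FH[OF that] D_pos by (intro mult_mono) auto
      ultimately show ?thesis by (simp add: R_def K_def algebra_simps)
    qed
    define J where "J = integral {0..T} H"
    have H_int: "(H has_integral J) {0..T}"
      unfolding J_def by (intro integrable_integral integrable_continuous_real H)
    have "integral {0..T} R \<le> K * J"
      by (rule has_integral_le[OF integrable_integral[OF integrable_continuous_real[OF contR]]
            has_integral_mult_right[OF H_int] R_le])
    then have IJ: "k * integral {0..T} R \<le> k * K * J"
      using k by (simp add: mult_left_mono mult.assoc)
    have \<eta>_nonneg: "0 \<le> \<eta> t" for t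
      by (simp add: \<eta>_def)
    have "(\<integral>\<^sup>+t\<in>{0<..<T}. ennreal (k * ((t * (T - t)) ^ 4 * E t)) \<partial>lebesgue)
        \<le> (\<integral>\<^sup>+t\<in>{0<..<T}. ennreal (k * (\<eta> t * (F' t + M * H t))) \<partial>lebesgue)"
    proof (intro nn_integral_mono)
      fix t
      show "ennreal (k * ((t * (T - t)) ^ 4 * E t)) * indicator {0<..<T} t
          \<le> ennreal (k * (\<eta> t * (F' t + M * H t))) * indicator {0<..<T} t"
      proof (cases "t \<in> {0<..<T}")
        case True
        have "k * (\<eta> t * E t) \<le> k * (\<eta> t * (F' t + M * H t))"
          using E[OF True] k \<eta>_nonneg by (intro mult_left_mono) auto
        with True show ?thesis
          by (auto simp: \<eta>_def intro!: ennreal_leI)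
      qed simp
    qed
    \<comment> \<open>The integrand is nonnegative since it dominates a multiple of
      \<open>E\<close>; for such functions the Henstock-Kurzweil integral is the Lebesgue
      integral.\<close>
    also have "\<dots> = ennreal (k * integral {0..T} R)"
      unfolding nn_integral_completion
    proof (rule nn_integral_has_integral_lebesgue'[OF _ int])
      fix t assume "t \<in> {0<..<T}"
      from E[OF this] show "0 \<le> k * (\<eta> t * (F' t + M * H t))"
        by (intro mult_nonneg_nonneg k \<eta>_nonneg) linarith
    qed
    also have "\<dots> \<le> ennreal (k * K * J)"
      by (rule ennreal_leI[OF IJ])
    also have "\<dots> = ennreal (k * K) * ennreal J"
      using k K by (simp add: ennreal_mult')
    also have "ennreal J = (\<integral>\<^sup>+t\<in>{0<..<T}. ennreal (H t) \<partial>lebesgue)"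
      unfolding nn_integral_completion
    proof (rule nn_integral_has_integral_lebesgue'[symmetric])
      fix t assume "t \<in> {0<..<T}"
      then have "t \<in> {0..T}" by simp
      from FH[OF this] show "0 \<le> H t" by linarith
    qed (use H_int in \<open>simp add: has_integral_Icc_iff_Ioo\<close>)
    finally show "(\<integral>\<^sup>+t\<in>{0<..<T}. ennreal (k * ((t * (T - t)) ^ 4 * E t)) \<partial>lebesgue)
        \<le> ennreal (k * K) * (\<integral>\<^sup>+t\<in>{0<..<T}. ennreal (H t) \<partial>lebesgue)" .
  qed
qed

lemma nn_integral_I01: "(\<integral>\<^sup>+x. f x \<partial>I01) = (\<integral>\<^sup>+x\<in>{0<..<1}. f x \<partial>lebesgue)"
  by (rule nn_integral_restrict_space) simp

text \<open>This is exp (-r) \<le> 1 / r at r = 2 m / \<eta> with \<eta> = (t (T - t))^4. The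
  resulting polynomial weight vanishes at both ends of the time interval and is uniform in s \<ge>
  1.\<close>

lemma exp_weight_le:
  assumes "0 < t" "t < T" "s \<ge> 1" "m > 0" "Y x \<le> - m"
  shows "exp (2 * s * phi T Y t x) \<le> (t * (T - t)) ^ 4 / (2 * m)"
proof -
  define \<eta> where "\<eta> = (t * (T - t)) ^ 4"
  have \<eta>: "\<eta> > 0" using assms by (simp add: \<eta>_def)
  have "s * m \<le> s * - Y x" using assms by (intro mult_left_mono) auto
  moreover have "1 * m \<le> s * m" using assms by (intro mult_right_mono) auto
  ultimately have "2 * s * Y x \<le> - (2 * m)" by simp
  then have "2 * s * phi T Y t x \<le> - (2 * m / \<eta>)"
    using divide_right_mono[of "2 * s * Y x" "- (2 * m)" \<eta>] \<eta> by (simp add: phi_def Theta_def \<eta>_def)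
  then have "exp (2 * s * phi T Y t x) \<le> exp (- (2 * m / \<eta>))"
    by simp
  also have "\<dots> \<le> inverse (2 * m / \<eta>)"
    unfolding exp_minus
  proof (rule le_imp_inverse_le)
    show "2 * m / \<eta> \<le> exp (2 * m / \<eta>)"
      using exp_ge_add_one_self[of "2 * m / \<eta>"] by linarith
  qed (use \<eta> assms(4) in simp)
  finally show ?thesis by (simp add: \<eta>_def)
qed

lemma compact_interval_enlarge:
  fixes p q :: real
  assumes "p \<le> q" "open U" "{p..q} \<subseteq> U"
  obtains y z where "y < p" "q < z" "{y..z} \<subseteq> U"
proof -
  have "p \<in> U" "q \<in> U" using assms by auto
  then obtain d e where de: "d > 0" "cball p d \<subseteq> U" "e > 0" "cball q e \<subseteq> U"
    using assms(2) open_contains_cball by metis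
  have "{p - d..q + e} \<subseteq> {p..q} \<union> cball p d \<union> cball q e"
    by (auto simp: dist_real_def)
  with de assms(3) show thesis
    by (intro that[of "p - d" "q + e"]) auto
qed

theorem proposition4p2:
  fixes a b Y Y' :: "real \<Rightarrow> real"
    and x0 K1 K2 lam T c :: real
    and \<omega> \<omega>' :: "real set"
  assumes T_pos: "T > 0"
    and hyp: "hypB a b x0 K1 K2 lam"
    and omega: "open \<omega>" "is_interval \<omega>" "\<omega> \<subseteq> {0<..<1}"
    and omega': "open \<omega>'" "is_interval \<omega>'" "closure \<omega>' \<subseteq> \<omega>" "x0 \<notin> closure \<omega>'"
    and Y_cont: "continuous_on {0..1} Y"
    and Y_neg: "\<And>x. x \<in> {0..1} \<Longrightarrow> Y x < 0"
    and Y_deriv: "\<And>x. x \<in> {0..1} - {x0} \<Longrightarrow> (Y has_real_derivative Y' x) (at x within {0..1})"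
    and Y'_cont: "continuous_on ({0..1} - {x0}) Y'"
    and c_pos: "c > 0"
    and Y'_bound: "\<And>x. x \<in> {0..1} - {x0} \<Longrightarrow> \<bar>Y' x\<bar> \<le> c / sqrt (a x)"
  shows "\<exists>C>0. \<exists>s0>0. \<forall>vT \<in> domA2 a b lam. \<forall>v. is_solution a b lam T vT v \<longrightarrow>
    (\<forall>s\<ge>s0.
      (\<integral>\<^sup>+t\<in>{0<..<T}. (\<integral>\<^sup>+x\<in>\<omega>'.
         ennreal ((wderiv (v t) x)\<^sup>2 * exp (2 * s * phi T Y t x)) \<partial>lebesgue) \<partial>lebesgue)
      \<le> ennreal C * (\<integral>\<^sup>+t\<in>{0<..<T}. (\<integral>\<^sup>+x\<in>\<omega>. ennreal ((v t x)\<^sup>2) \<partial>lebesgue) \<partial>lebesgue))"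
proof (cases "\<omega>' = {}")
  \<comment> \<open>The empty set is split off because \<open>p \<le> q\<close> below requires a
    point of \<omega>'.\<close>
  case True
  then show ?thesis
    by (intro exI[of _ 1] conjI) auto
next
  case False
  have deg: "degenerate a b x0 K1 K2"
    using hyp by (auto simp: hypB_def WWD_def WSD_def SWD_def SSD_def)
  then have cont: "continuous_on {0..1} a" "continuous_on {0..1} b"
    and pos: "\<And>x. x \<in> {0..1} - {x0} \<Longrightarrow> a x > 0 \<and> b x > 0" and a0: "a x0 = 0"
    by (auto simp: degenerate_def)
  have a_nonneg: "0 \<le> a x" if "x \<in> {0..1}" for x
    using pos[of x] a0 that by (cases "x = x0") auto
  have "bounded (closure \<omega>')"
    using omega'(3) omega(3) by (intro bounded_subset[OF bounded_box[of "0::real" 1, unfolded box_real]]) auto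
  then have "connected (closure \<omega>') \<and> compact (closure \<omega>')"
    using omega'(2) by (auto simp: compact_eq_bounded_closed is_interval_connected_1 connected_imp_connected_closure)
  then obtain p q where pq: "closure \<omega>' = {p..q}"
    unfolding connected_compact_interval_1 by blast
  have "p \<le> q"
    using False pq closure_subset[of \<omega>'] by force
  \<comment> \<open>Since \<open>x0\<close> is outside the closure of \<omega>', there is room to
    enlarge [p,q] inside \<omega> without meeting \<open>x0\<close>: \<open>a\<close> and
    \<open>b\<close> are positive on [y,z], and the cutoff is positive on [p,q].\<close>
  have "open (\<omega> - {x0})" "{p..q} \<subseteq> \<omega> - {x0}"
    using omega(1) omega'(3,4) pq by (auto simp: open_delete)
  from compact_interval_enlarge[OF \<open>p \<le> q\<close> this]
  obtain y z where yp: "y < p" and qz: "q < z" and yz\<omega>: "{y..z} \<subseteq> \<omega> - {x0}"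
    by metis
  have yz: "0 < y" "y < z" "z < 1"
    using yz\<omega> omega(3) yp qz \<open>p \<le> q\<close> by (auto simp: subset_iff)
  have pos_yz: "0 < a x" "0 < b x" if "x \<in> {y..z}" for x
  proof -
    have "x \<noteq> x0" using that yz\<omega> by blast
    then show "0 < a x" "0 < b x" using pos[of x] that yz by auto
  qed
  define \<theta> where "\<theta> = bump 1 y z"
  have \<theta>sm: "smooth \<theta>" unfolding \<theta>_def by (rule smooth_bump) (use yz in auto)
  have \<theta>2_le: "(\<theta> x)\<^sup>2 \<le> indicator {y..z} x" for x
    using bump_bounds[of 1 y z x] by (auto simp: \<theta>_def bump_def indicator_def intro: power_le_one)
  obtain M where M: "M \<ge> 0" and energy: "\<And>u v. u \<in> H2ab a b lam \<Longrightarrow> v \<in> L2 \<Longrightarrow>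
      AE x in I01. v x + opA a b lam u x = 0 \<Longrightarrow>
      integrable I01 (\<lambda>x. (\<theta> x)\<^sup>2 * a x * (wderiv u x)\<^sup>2) \<and>
      (\<integral>x. (\<theta> x)\<^sup>2 * a x * (wderiv u x)\<^sup>2 \<partial>I01)
        \<le> 2 * (\<integral>x. (\<theta> x)\<^sup>2 * (u x * v x) \<partial>I01) + M * (\<integral>x. indicator {y..z} x * (u x)\<^sup>2 \<partial>I01)"
    by (rule energy_inequality[OF cont a_nonneg pos_yz(2) yz, of lam, folded \<theta>_def],
        assumption, assumption, rule that)
  obtain K where K: "K > 0" and time: "\<forall>E F F' H k. k \<ge> 0 \<longrightarrow>
      (\<forall>t\<in>{0..T}. (F has_real_derivative F' t) (at t within {0..T})) \<longrightarrow>
      continuous_on {0..T} H \<longrightarrow>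
      (\<forall>t\<in>{0<..<T}. 0 \<le> E t \<and> E t \<le> F' t + M * H t) \<longrightarrow>
      (\<forall>t\<in>{0..T}. 0 \<le> F t \<and> F t \<le> H t) \<longrightarrow>
      (\<integral>\<^sup>+t\<in>{0<..<T}. ennreal (k * ((t * (T - t)) ^ 4 * E t)) \<partial>lebesgue)
        \<le> ennreal (k * K) * (\<integral>\<^sup>+t\<in>{0<..<T}. ennreal (H t) \<partial>lebesgue)"
    using weighted_energy_nn_integral_le[OF T_pos M] by (elim exE conjE)
  \<comment> \<open>The minimum \<kappa> of \<theta>^2 a on [p,q] converts the square of the
    derivative on \<omega>' into energy density.\<close>
  have "\<exists>x\<in>{p..q}. \<forall>u\<in>{p..q}. (\<theta> x)\<^sup>2 * a x \<le> (\<theta> u)\<^sup>2 * a u"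
    using \<open>p \<le> q\<close> yp qz yz
    by (intro continuous_attains_inf continuous_intros continuous_on_subset[OF cont(1)]
        continuous_at_imp_continuous_on ballI smooth_isCont \<theta>sm) auto
  moreover have "(\<theta> x)\<^sup>2 * a x > 0" if "x \<in> {p..q}" for x
    using that yp qz pos_yz(1)[of x] by (auto simp: \<theta>_def bump_def)
  ultimately obtain \<kappa> where \<kappa>: "\<kappa> > 0" "\<And>x. x \<in> {p..q} \<Longrightarrow> \<kappa> \<le> (\<theta> x)\<^sup>2 * a x"
    by blast
  have "\<exists>x\<in>{p..q}. \<forall>u\<in>{p..q}. Y u \<le> Y x"
    using \<open>p \<le> q\<close> yp qz yz by (intro continuous_attains_sup continuous_on_subset[OF Y_cont]) auto
  then obtain \<xi> where \<xi>: "\<xi> \<in> {p..q}" "\<And>x. x \<in> {p..q} \<Longrightarrow> Y x \<le> Y \<xi>"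
    by blast
  define m where "m = - Y \<xi>"
  have m: "m > 0" "\<And>x. x \<in> {p..q} \<Longrightarrow> Y x \<le> - m"
    using \<xi> Y_neg[of \<xi>] yp qz yz by (auto simp: m_def)
  \<comment> \<open>The factor 1 / (2 m) comes from \<open>exp_weight_le\<close>, and 1 / \<kappa>
    from the lower bound of \<theta>^2 a.\<close>
  define k where "k = 1 / (2 * m * \<kappa>)"
  have k: "k > 0" using m(1) \<kappa>(1) by (simp add: k_def)
  have main: "(\<integral>\<^sup>+t\<in>{0<..<T}. (\<integral>\<^sup>+x\<in>\<omega>'.
         ennreal ((wderiv (v t) x)\<^sup>2 * exp (2 * s * phi T Y t x)) \<partial>lebesgue) \<partial>lebesgue)
      \<le> ennreal (k * K) * (\<integral>\<^sup>+t\<in>{0<..<T}. (\<integral>\<^sup>+x\<in>\<omega>. ennreal ((v t x)\<^sup>2) \<partial>lebesgue) \<partial>lebesgue)"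
    if sol: "is_solution a b lam T vT v" and s: "s \<ge> 1" for vT v s
  proof -
    obtain vt where vt: "has_L2_derivative_on {0..T} v vt"
      "\<And>t. t \<in> {0<..<T} \<Longrightarrow> AE x in I01. vt t x + opA a b lam (v t) x = 0"
      and v: "\<And>t. t \<in> {0..T} \<Longrightarrow> v t \<in> H2ab a b lam" "L2_continuous_on {0..T} v"
      using sol by (auto simp: is_solution_def)
    have L2: "v t \<in> L2" "vt t \<in> L2" if "t \<in> {0..T}" for t
      using vt(1) that by (auto simp: has_L2_derivative_on_def)
    define E where "E t = (\<integral>x. (\<theta> x)\<^sup>2 * a x * (wderiv (v t) x)\<^sup>2 \<partial>I01)" for t
    define F where "F t = (\<integral>x. (\<theta> x)\<^sup>2 * (v t x)\<^sup>2 \<partial>I01)" for t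
    define F' where "F' t = 2 * (\<integral>x. (\<theta> x)\<^sup>2 * (v t x * vt t x) \<partial>I01)" for t
    define H where "H t = (\<integral>x. indicator {y..z} x * (v t x)\<^sup>2 \<partial>I01)" for t
    have meas_\<theta>: "(\<lambda>x. (\<theta> x)\<^sup>2) \<in> borel_measurable I01"
      by (intro borel_measurable_power borel_measurable_I01_if_isCont smooth_isCont \<theta>sm)
    have meas_ind: "(indicator {y..z} :: real \<Rightarrow> real) \<in> borel_measurable I01"
      by (rule measurable_restrict_space1, rule borel_measurable_indicator, simp)
    have bound_\<theta>: "\<bar>(\<theta> x)\<^sup>2\<bar> \<le> 1" and bound_ind: "\<bar>indicator {y..z} x :: real\<bar> \<le> 1" for x
      using order_trans[OF \<theta>2_le[of x] indicator_le_1] by (simp_all add: indicator_def)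
    have F_deriv: "(F has_real_derivative F' t) (at t within {0..T})" if "t \<in> {0..T}" for t
      using has_derivative_weighted_energy[OF vt(1) v(2) that meas_\<theta> bound_\<theta>]
      by (simp add: F_def[abs_def] F'_def)
    \<comment> \<open>With the indicator of [y,z] as weight, the derivative lemma shows
      \<open>H\<close> differentiable, hence continuous.\<close>
    have H_cont: "continuous_on {0..T} H"
      using has_derivative_weighted_energy[OF vt(1) v(2) _ meas_ind bound_ind]
      by (intro DERIV_continuous_on) (simp add: H_def[abs_def])
    have E_le: "0 \<le> E t \<and> E t \<le> F' t + M * H t"
      and E_int: "integrable I01 (\<lambda>x. (\<theta> x)\<^sup>2 * a x * (wderiv (v t) x)\<^sup>2)" if "t \<in> {0<..<T}" for t
    proof -
      have "t \<in> {0..T}" using that by simp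
      note * = energy[OF v(1)[OF this] L2(2)[OF this] vt(2)[OF that]]
      moreover have "0 \<le> E t"
        unfolding E_def using a_nonneg by (intro integral_nonneg_AE AE_I2) auto
      ultimately show "0 \<le> E t \<and> E t \<le> F' t + M * H t"
        by (simp add: E_def F'_def H_def)
      show "integrable I01 (\<lambda>x. (\<theta> x)\<^sup>2 * a x * (wderiv (v t) x)\<^sup>2)"
        using * by simp
    qed
    have int: "integrable I01 (\<lambda>x. (\<theta> x)\<^sup>2 * (v t x)\<^sup>2)" "integrable I01 (\<lambda>x. indicator {y..z} x * (v t x)\<^sup>2)"
      if "t \<in> {0..T}" for t
      using integral_weight_mult_le(1)[OF L2(1)[OF that] L2(1)[OF that] meas_\<theta> bound_\<theta>]
        integral_weight_mult_le(1)[OF L2(1)[OF that] L2(1)[OF that] meas_ind bound_ind]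
      by (simp_all add: power2_eq_square)
    have FH: "0 \<le> F t \<and> F t \<le> H t" if "t \<in> {0..T}" for t
    proof
      show "0 \<le> F t" by (simp add: F_def)
      show "F t \<le> H t"
        unfolding F_def H_def by (intro integral_mono int that mult_right_mono \<theta>2_le) simp
    qed
    have "(\<integral>\<^sup>+t\<in>{0<..<T}. (\<integral>\<^sup>+x\<in>\<omega>'.
         ennreal ((wderiv (v t) x)\<^sup>2 * exp (2 * s * phi T Y t x)) \<partial>lebesgue) \<partial>lebesgue)
      \<le> (\<integral>\<^sup>+t\<in>{0<..<T}. ennreal (k * ((t * (T - t)) ^ 4 * E t)) \<partial>lebesgue)"
    proof (intro nn_integral_mono)
      fix t
      show "(\<integral>\<^sup>+x\<in>\<omega>'. ennreal ((wderiv (v t) x)\<^sup>2 * exp (2 * s * phi T Y t x)) \<partial>lebesgue) * indicator {0<..<T} t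
        \<le> ennreal (k * ((t * (T - t)) ^ 4 * E t)) * indicator {0<..<T} t"
      proof (cases "t \<in> {0<..<T}")
        case t: True
        define N where "N = (t * (T - t)) ^ 4"
        have N: "N \<ge> 0" by (simp add: N_def)
        define f where "f = (\<lambda>x. k * N * ((\<theta> x)\<^sup>2 * a x * (wderiv (v t) x)\<^sup>2))"
        have f_nonneg: "0 \<le> f x" if "x \<in> {0..1}" for x
          using k N a_nonneg[OF that] by (simp add: f_def)
        \<comment> \<open>The exponential is at most \<eta> / (2 m), and 1 \<le> \<theta>^2 a /
          \<kappa> on [p,q]. From here on \<open>s\<close> has disappeared.\<close>
        have le_f: "(wderiv (v t) x)\<^sup>2 * exp (2 * s * phi T Y t x) \<le> f x" if "x \<in> \<omega>'" for x
        proof -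
          have x: "x \<in> {p..q}" using that closure_subset[of \<omega>'] pq by auto
          have "exp (2 * s * phi T Y t x) \<le> N / (2 * m) * 1"
            using exp_weight_le[of t T s m Y x] s m(1) m(2)[OF x] t by (simp add: N_def)
          also have "\<dots> \<le> N / (2 * m) * ((\<theta> x)\<^sup>2 * a x / \<kappa>)"
            using \<kappa>(2)[OF x] \<kappa>(1) N m(1) by (intro mult_left_mono) auto
          also have "\<dots> = k * N * ((\<theta> x)\<^sup>2 * a x)"
            by (simp add: k_def)
          finally have "(wderiv (v t) x)\<^sup>2 * exp (2 * s * phi T Y t x)
              \<le> (wderiv (v t) x)\<^sup>2 * (k * N * ((\<theta> x)\<^sup>2 * a x))"
            by (rule mult_left_mono) simp
          then show ?thesis by (simp add: f_def mult_ac)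
        qed
        have "(\<integral>\<^sup>+x\<in>\<omega>'. ennreal ((wderiv (v t) x)\<^sup>2 * exp (2 * s * phi T Y t x)) \<partial>lebesgue)
            \<le> (\<integral>\<^sup>+x\<in>{0<..<1}. ennreal (f x) \<partial>lebesgue)"
        proof (intro nn_integral_mono)
          fix x
          show "ennreal ((wderiv (v t) x)\<^sup>2 * exp (2 * s * phi T Y t x)) * indicator \<omega>' x
              \<le> ennreal (f x) * indicator {0<..<1} x"
          proof (cases "x \<in> \<omega>'")
            case True
            moreover have "x \<in> {0<..<1}"
              using True closure_subset omega'(3) omega(3) by blast
            ultimately show ?thesis
              using le_f[OF True] by (simp add: ennreal_leI)
          qed simp
        qed
        also have "\<dots> = (\<integral>\<^sup>+x. ennreal (f x) \<partial>I01)"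
          by (simp add: nn_integral_I01)
        also have "\<dots> = ennreal (\<integral>x. f x \<partial>I01)"
          by (rule nn_integral_eq_integral)
             (use E_int[OF t] f_nonneg in \<open>auto simp: f_def\<close>)
        also have "(\<integral>x. f x \<partial>I01) = k * (N * E t)"
          by (simp add: f_def E_def mult.assoc)
        finally show ?thesis
          using t by (simp add: N_def)
      qed simp
    qed
    also have "\<dots> \<le> ennreal (k * K) * (\<integral>\<^sup>+t\<in>{0<..<T}. ennreal (H t) \<partial>lebesgue)"
      by (rule time[rule_format, OF _ F_deriv H_cont E_le FH]) (use k in auto)
    also have "\<dots> \<le> ennreal (k * K) * (\<integral>\<^sup>+t\<in>{0<..<T}. (\<integral>\<^sup>+x\<in>\<omega>. ennreal ((v t x)\<^sup>2) \<partial>lebesgue) \<partial>lebesgue)"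
    proof (intro mult_left_mono nn_integral_mono)
      fix t
      show "ennreal (H t) * indicator {0<..<T} t
        \<le> (\<integral>\<^sup>+x\<in>\<omega>. ennreal ((v t x)\<^sup>2) \<partial>lebesgue) * indicator {0<..<T} t"
      proof (cases "t \<in> {0<..<T}")
        case True
        then have "ennreal (H t) = (\<integral>\<^sup>+x. ennreal (indicator {y..z} x * (v t x)\<^sup>2) \<partial>I01)"
          unfolding H_def by (intro nn_integral_eq_integral[symmetric] int) auto
        also have "\<dots> = (\<integral>\<^sup>+x\<in>{0<..<1}. ennreal (indicator {y..z} x * (v t x)\<^sup>2) \<partial>lebesgue)"
          by (rule nn_integral_I01)
        also have "\<dots> \<le> (\<integral>\<^sup>+x\<in>\<omega>. ennreal ((v t x)\<^sup>2) \<partial>lebesgue)"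
          using yz\<omega> by (intro nn_integral_mono) (auto simp: indicator_def)
        finally show ?thesis using True by simp
      qed simp
    qed simp
    finally show ?thesis .
  qed
  \<comment> \<open>\<open>k\<close> and \<open>K\<close> were fixed before the solution and
    \<open>s\<close>, so k K is a uniform constant; s0 = 1 is the threshold of
    \<open>exp_weight_le\<close>.\<close>
  show ?thesis
    by (rule exI[of _ "k * K"], intro conjI exI[of _ 1] ballI allI impI main) (use k K in auto)
qed

end
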